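(* Let $K$ be a nonzero Poisson ideal of $\mathrm{S}(W_+)$. Then there are only finitely many prime ideals of $\mathrm{S}(W_+)$ that are minimal over $K$, and the Gelfand-Kirillov dimension of $\mathrm{S}(W_+)/K$ is finite, i.e. $\operatorname{GKdim}\mathrm{S}(W_+)/K<\infty$.
   Context: $\Bbbk$ is a field of characteristic zero. The positive Witt algebra $W_+$ is the Lie algebra over $\Bbbk$ with basis $\{e_n : n\in\mathbb{Z}_{\geq 1}\}$ and bracket $[e_i,e_j]=(j-i)e_{i+j}$. Its symmetric algebra $\mathrm{S}(W_+)$ is the polynomial ring $\Bbbk[x_1,x_2,\dots]$ ($x_i$ being the image of $e_i$), with the Poisson bracket determined by $\{x_i,x_j\}=(j-i)x_{i+j}$ and the Leibniz rule. A Poisson ideal is an ideal $I$ with $\{f,g\}\in I$ for all $f\in I$, $g\in\mathrm{S}(W_+)$. The Gelfand-Kirillov dimension of a $\Bbbk$-algebra $R$ is $\operatorname{GKdim}R=\sup_V\limsup_{n\to\infty}\log_n\dim_\Bbbk\left(\sum_{k=0}^nV^k\right)$, the supremum over finite-dimensional subspaces $V\subseteq R$ (for the zero algebra this is $-\infty$, which counts as $<\infty$). *)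

theory Defs
  imports
    "HOL-Library.Poly_Mapping"
    "HOL-Library.Extended_Real"
    "HOL-Algebra.QuotRing"
    "Jordan_Normal_Form.VS_Connect"
begin

section \<open>Quotient algebras and Gelfand-Kirillov dimension\<close>

text \<open>
  Algebras over a field \<open>R\<close> are records of type \<^typ>\<open>('a, 'b) module\<close>, which carry a ring
  multiplication as well as a scalar multiplication (cf. the locale \<^locale>\<open>algebra\<close>).
\<close>

definition quot_algebra :: "('a, 'b, 'c) module_scheme \<Rightarrow> 'b set \<Rightarrow> ('a, 'b set) module" where
  "quot_algebra A I =
     \<lparr>carrier = carrier (A Quot I), mult = mult (A Quot I), one = one (A Quot I),
      zero = zero (A Quot I), add = add (A Quot I),
      smult = (\<lambda>c X. \<Union>x\<in>X. I +>\<^bsub>A\<^esub> (c \<odot>\<^bsub>A\<^esub> x))\<rparr>"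

primrec subspace_power ::
  "('a, 'd) ring_scheme \<Rightarrow> ('a, 'b, 'c) module_scheme \<Rightarrow> 'b set \<Rightarrow> nat \<Rightarrow> 'b set" where
  "subspace_power R A V 0 = module.span R A {\<one>\<^bsub>A\<^esub>}"
| "subspace_power R A V (Suc k) =
     module.span R A {v \<otimes>\<^bsub>A\<^esub> w | v w. v \<in> subspace_power R A V k \<and> w \<in> V}"

text \<open>The sum \<open>V\<^sup>0 + \<dots> + V\<^sup>n\<close> of subspaces.\<close>

definition subspace_power_sum ::
  "('a, 'd) ring_scheme \<Rightarrow> ('a, 'b, 'c) module_scheme \<Rightarrow> 'b set \<Rightarrow> nat \<Rightarrow> 'b set" where
  "subspace_power_sum R A V n = module.span R A (\<Union>k\<le>n. subspace_power R A V k)"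

text \<open>
  The logarithm of a dimension, with \<open>log 0 = -\<infinity>\<close>, so that the zero algebra has
  Gelfand-Kirillov dimension \<open>-\<infinity>\<close>.
\<close>

definition log_dim :: "nat \<Rightarrow> nat \<Rightarrow> ereal" where
  "log_dim n d = (if d = 0 then -\<infinity> else ereal (log (real n) (real d)))"

definition gk_dim :: "('a, 'd) ring_scheme \<Rightarrow> ('a, 'b, 'c) module_scheme \<Rightarrow> ereal" where
  "gk_dim R A =
     (SUP V \<in> {V. VectorSpace.subspace R V A \<and> vectorspace.fin_dim R (A\<lparr>carrier := V\<rparr>)}.
        limsup (\<lambda>n. log_dim n
          (vectorspace.dim R (A\<lparr>carrier := subspace_power_sum R A V n\<rparr>))))"


section \<open>Minimal primes\<close>

definition minimal_prime_over :: "('a, 'b) ring_scheme \<Rightarrow> 'a set \<Rightarrow> 'a set \<Rightarrow> bool" where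
  "minimal_prime_over R I P \<longleftrightarrow>
     primeideal P R \<and> I \<subseteq> P \<and> (\<forall>Q. primeideal Q R \<and> I \<subseteq> Q \<and> Q \<subseteq> P \<longrightarrow> Q = P)"


section \<open>The symmetric algebra of the positive Witt algebra\<close>

text \<open>
  A monomial is a finitely supported exponent vector, a polynomial a finitely supported function
  on monomials.  The variables \<open>x\<^sub>1, x\<^sub>2, \<dots>\<close> are indexed from 1 but exponent vectors are indexed by
  \<^typ>\<open>nat\<close>: the exponent of \<open>x\<^sub>n\<close> (\<open>n \<ge> 1\<close>) is stored at position \<open>n - 1\<close>.
\<close>

type_synonym 'k witt_poly = "(nat \<Rightarrow>\<^sub>0 nat) \<Rightarrow>\<^sub>0 'k"

definition witt_const :: "'k \<Rightarrow> 'k::field witt_poly" where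
  "witt_const c = Poly_Mapping.single 0 c"

definition witt_gen :: "nat \<Rightarrow> 'k::field witt_poly" where
  "witt_gen n = Poly_Mapping.single (Poly_Mapping.single (n - 1) 1) 1"

definition witt_sym :: "('k::field, 'k witt_poly) module" where
  "witt_sym = \<lparr>carrier = UNIV, mult = (*), one = 1, zero = 0, add = (+),
     smult = (\<lambda>c f. witt_const c * f)\<rparr>"

text \<open>The set \<open>witt_vars f\<close> contains the positions of the variables that occur in \<open>f\<close>.\<close>

definition witt_vars :: "'k::field witt_poly \<Rightarrow> nat set" where
  "witt_vars f = (\<Union>m\<in>Poly_Mapping.keys f. Poly_Mapping.keys m)"

text \<open>The partial derivative with respect to the variable at position \<open>p\<close>, i.e. \<open>x\<^bsub>p+1\<^esub>\<close>.\<close>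

definition witt_pderiv :: "nat \<Rightarrow> 'k::field witt_poly \<Rightarrow> 'k witt_poly" where
  "witt_pderiv p f =
     (\<Sum>m\<in>Poly_Mapping.keys f.
        Poly_Mapping.single (m - Poly_Mapping.single p 1)
          (of_nat (Poly_Mapping.lookup m p) * Poly_Mapping.lookup f m))"

text \<open>
  The biderivation formula \<open>{f, g} = \<Sum>\<^bsub>i,j\<ge>1\<^esub> (j - i) x\<^bsub>i+j\<^esub> (\<partial>f/\<partial>x\<^sub>i) (\<partial>g/\<partial>x\<^sub>j)\<close> with \<open>i = p + 1\<close> and
  \<open>j = q + 1\<close>.  The lemmas below show that it is the unique \<open>k\<close>-bilinear map satisfying the Leibniz
  rule in both arguments and \<open>{x\<^sub>i, x\<^sub>j} = (j - i) x\<^bsub>i+j\<^esub>\<close> for all \<open>i, j \<ge> 1\<close>.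
\<close>

definition witt_bracket :: "'k::field witt_poly \<Rightarrow> 'k witt_poly \<Rightarrow> 'k witt_poly" where
  "witt_bracket f g =
     (\<Sum>p\<in>witt_vars f. \<Sum>q\<in>witt_vars g.
        witt_const (of_int (int q - int p)) * witt_gen ((p + 1) + (q + 1)) *
        witt_pderiv p f * witt_pderiv q g)"

definition witt_poisson_ideal :: "'k::field witt_poly set \<Rightarrow> bool" where
  "witt_poisson_ideal I \<longleftrightarrow> ideal I witt_sym \<and> (\<forall>f\<in>I. \<forall>g. witt_bracket f g \<in> I)"


subsection \<open>Characterisation of the Poisson bracket\<close>

lemma finite_witt_vars: "finite (witt_vars f)"
  by (simp add: witt_vars_def)

lemma witt_pderiv_superset:
  assumes "finite A" "Poly_Mapping.keys f \<subseteq> A"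
  shows "witt_pderiv p f =
    (\<Sum>m\<in>A. Poly_Mapping.single (m - Poly_Mapping.single p 1)
        (of_nat (Poly_Mapping.lookup m p) * Poly_Mapping.lookup f m))"
  unfolding witt_pderiv_def
  by (rule sum.mono_neutral_left) (use assms in \<open>auto simp: in_keys_iff\<close>)

lemma witt_pderiv_add: "witt_pderiv p (f + g) = witt_pderiv p f + witt_pderiv p g"
proof -
  let ?A = "Poly_Mapping.keys f \<union> Poly_Mapping.keys g"
  have "Poly_Mapping.keys (f + g) \<subseteq> ?A" by (rule keys_add)
  then show ?thesis
    by (simp add: witt_pderiv_superset[of ?A] lookup_add distrib_left single_add sum.distrib)
qed

lemma witt_pderiv_0 [simp]: "witt_pderiv p 0 = 0"
  by (simp add: witt_pderiv_def)

lemma witt_pderiv_sum: "witt_pderiv p (sum h A) = (\<Sum>a\<in>A. witt_pderiv p (h a))"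
  by (induction A rule: infinite_finite_induct) (simp_all add: witt_pderiv_add)

lemma witt_pderiv_single:
  "witt_pderiv p (Poly_Mapping.single m c) =
     Poly_Mapping.single (m - Poly_Mapping.single p 1) (of_nat (Poly_Mapping.lookup m p) * c)"
  by (simp add: witt_pderiv_def)

lemma witt_poly_sum_monomials:
  fixes f :: "'k::field witt_poly"
  shows "f = (\<Sum>m\<in>Poly_Mapping.keys f. Poly_Mapping.single m (Poly_Mapping.lookup f m))"
proof (rule poly_mapping_eqI)
  fix n
  show "Poly_Mapping.lookup f n = Poly_Mapping.lookup
      (\<Sum>m\<in>Poly_Mapping.keys f. Poly_Mapping.single m (Poly_Mapping.lookup f m)) n"
    by (simp add: lookup_sum lookup_single when_def in_keys_iff sum.delta)
qed

lemma witt_pderiv_mult_single: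
  fixes c d :: "'k::field"
  shows "witt_pderiv p (Poly_Mapping.single m c * Poly_Mapping.single n d) =
    witt_pderiv p (Poly_Mapping.single m c) * Poly_Mapping.single n d +
    Poly_Mapping.single m c * witt_pderiv p (Poly_Mapping.single n d)"
proof -
  let ?e = "Poly_Mapping.single p (1::nat)"
  have *: "a + b - ?e = (a - ?e) + b" if "Poly_Mapping.lookup a p \<noteq> 0" for a b :: "nat \<Rightarrow>\<^sub>0 nat"
    by (rule poly_mapping_eqI)
      (use that in \<open>auto simp: lookup_add lookup_minus lookup_single when_def\<close>)
  have 1: "Poly_Mapping.single (m + n - ?e) (of_nat (Poly_Mapping.lookup m p) * (c * d)) =
        Poly_Mapping.single ((m - ?e) + n) (of_nat (Poly_Mapping.lookup m p) * (c * d))"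
    by (cases "Poly_Mapping.lookup m p = 0") (use *[of m n] in auto)
  have 2: "Poly_Mapping.single (m + n - ?e) (of_nat (Poly_Mapping.lookup n p) * (c * d)) =
        Poly_Mapping.single (m + (n - ?e)) (of_nat (Poly_Mapping.lookup n p) * (c * d))"
    by (cases "Poly_Mapping.lookup n p = 0") (use *[of n m] in \<open>auto simp: add.commute\<close>)
  show ?thesis
    by (simp only: mult_single witt_pderiv_single lookup_add of_nat_add distrib_right single_add 1 2
        mult.assoc mult.left_commute[of c])
qed

lemma witt_pderiv_mult:
  "witt_pderiv p (f * g) = witt_pderiv p f * g + f * witt_pderiv p g"
proof -
  define s t where "s m = Poly_Mapping.single m (Poly_Mapping.lookup f m)"
    and "t m = Poly_Mapping.single m (Poly_Mapping.lookup g m)" for m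
  let ?A = "Poly_Mapping.keys f" and ?B = "Poly_Mapping.keys g"
  have f: "f = sum s ?A" and g: "g = sum t ?B"
    unfolding s_def t_def by (rule witt_poly_sum_monomials)+
  have st: "witt_pderiv p (s m * t n) = witt_pderiv p (s m) * t n + s m * witt_pderiv p (t n)" for m n
    unfolding s_def t_def by (rule witt_pderiv_mult_single)
  have "witt_pderiv p (sum s ?A * sum t ?B) =
      witt_pderiv p (sum s ?A) * sum t ?B + sum s ?A * witt_pderiv p (sum t ?B)"
    by (simp add: sum_product witt_pderiv_sum st sum.distrib)
  then show ?thesis using f g by simp
qed

lemma witt_pderiv_const [simp]: "witt_pderiv p (witt_const c) = 0"
  by (simp add: witt_const_def witt_pderiv_single)

lemma witt_pderiv_gen: "witt_pderiv p (witt_gen n) = (if p = n - 1 then 1 else 0)"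
  by (auto simp: witt_gen_def witt_pderiv_single lookup_single when_def)

lemma witt_pderiv_eq_0:
  assumes "p \<notin> witt_vars f"
  shows "witt_pderiv p f = 0"
proof -
  have "Poly_Mapping.lookup m p = 0" if "m \<in> Poly_Mapping.keys f" for m
    using assms that by (auto simp: witt_vars_def in_keys_iff)
  then show ?thesis by (simp add: witt_pderiv_def)
qed

lemma witt_bracket_superset:
  assumes "finite A" "witt_vars f \<subseteq> A" "finite B" "witt_vars g \<subseteq> B"
  shows "witt_bracket f g = (\<Sum>p\<in>A. \<Sum>q\<in>B.
        witt_const (of_int (int q - int p)) * witt_gen ((p + 1) + (q + 1)) *
        witt_pderiv p f * witt_pderiv q g)"
proof -
  have "witt_bracket f g = (\<Sum>p\<in>A. \<Sum>q\<in>witt_vars g.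
        witt_const (of_int (int q - int p)) * witt_gen ((p + 1) + (q + 1)) *
        witt_pderiv p f * witt_pderiv q g)"
    unfolding witt_bracket_def
    by (rule sum.mono_neutral_left) (use assms in \<open>auto simp: witt_pderiv_eq_0\<close>)
  also have "\<dots> = (\<Sum>p\<in>A. \<Sum>q\<in>B.
        witt_const (of_int (int q - int p)) * witt_gen ((p + 1) + (q + 1)) *
        witt_pderiv p f * witt_pderiv q g)"
    by (intro sum.cong refl sum.mono_neutral_left) (use assms in \<open>auto simp: witt_pderiv_eq_0\<close>)
  finally show ?thesis .
qed

lemma witt_bracket_add_left: "witt_bracket (f + g) h = witt_bracket f h + witt_bracket g h"
  by (simp add: witt_bracket_superset[of "witt_vars f \<union> witt_vars g \<union> witt_vars (f + g)" _ "witt_vars h"]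
      finite_witt_vars le_supI1 witt_pderiv_add algebra_simps sum.distrib)

lemma witt_bracket_smult_left: "witt_bracket (witt_const c * f) h = witt_const c * witt_bracket f h"
  by (simp add: witt_bracket_superset[of "witt_vars f \<union> witt_vars (witt_const c * f)" _ "witt_vars h"]
      finite_witt_vars witt_pderiv_mult sum_distrib_left mult_ac)

lemma witt_bracket_mult_left:
  "witt_bracket (f * g) h = f * witt_bracket g h + witt_bracket f h * g"
  by (simp add: witt_bracket_superset[of "witt_vars f \<union> witt_vars g \<union> witt_vars (f * g)" _ "witt_vars h"]
      finite_witt_vars le_supI1 witt_pderiv_mult sum_distrib_left sum_distrib_right algebra_simps
      sum.distrib)

lemma witt_bracket_skew: "witt_bracket f g = - witt_bracket g f"
proof -
  have c: "witt_const (of_int (int q - int p) :: 'k::field) = - witt_const (of_int (int p - int q))"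
    for p q by (simp add: witt_const_def flip: single_uminus)
  have "witt_bracket f g = (\<Sum>q\<in>witt_vars g. \<Sum>p\<in>witt_vars f.
        witt_const (of_int (int q - int p)) * witt_gen ((p + 1) + (q + 1)) *
        witt_pderiv p f * witt_pderiv q g)"
    unfolding witt_bracket_def by (rule sum.swap)
  also have "\<dots> = - witt_bracket g f"
    unfolding witt_bracket_def sum_negf[symmetric]
  proof (intro sum.cong refl)
    fix q p
    show "witt_const (of_int (int q - int p)) * witt_gen ((p + 1) + (q + 1)) *
        witt_pderiv p f * witt_pderiv q g =
      - (witt_const (of_int (int p - int q)) * witt_gen ((q + 1) + (p + 1)) *
        witt_pderiv q g * witt_pderiv p f)"
      by (subst c) (simp add: mult_ac add_ac)
  qed
  finally show ?thesis .
qed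

lemma witt_bracket_add_right: "witt_bracket h (f + g) = witt_bracket h f + witt_bracket h g"
  by (simp add: witt_bracket_skew[of h] witt_bracket_add_left)

lemma witt_bracket_smult_right: "witt_bracket h (witt_const c * f) = witt_const c * witt_bracket h f"
  by (simp add: witt_bracket_skew[of h] witt_bracket_smult_left)

lemma witt_bracket_mult_right:
  "witt_bracket h (f * g) = f * witt_bracket h g + witt_bracket h f * g"
  by (simp add: witt_bracket_skew[of h] witt_bracket_mult_left)

lemma witt_bracket_gen:
  assumes "i \<ge> 1" "j \<ge> 1"
  shows "witt_bracket (witt_gen i) (witt_gen j) =
           witt_const (of_int (int j - int i)) * witt_gen (i + j)"
proof -
  have v: "witt_vars (witt_gen n :: 'k::field witt_poly) = {n - 1}" for n
    by (simp add: witt_vars_def witt_gen_def)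
  show ?thesis
    using assms by (simp add: witt_bracket_def v witt_pderiv_gen of_nat_diff)
qed

lemma witt_poly_induct [case_names const gen add mult]:
  fixes f :: "'k::field witt_poly"
  assumes const: "\<And>c. P (witt_const c)"
    and gen: "\<And>n. n \<ge> 1 \<Longrightarrow> P (witt_gen n)"
    and add: "\<And>f g. P f \<Longrightarrow> P g \<Longrightarrow> P (f + g)"
    and mult: "\<And>f g. P f \<Longrightarrow> P g \<Longrightarrow> P (f * g)"
  shows "P f"
proof -
  have one: "P 1" using const[of 1] by (simp add: witt_const_def)
  have zero: "P 0" using const[of 0] by (simp add: witt_const_def)
  have var: "P (Poly_Mapping.single (Poly_Mapping.single p k) 1)" for p k
  proof (induction k)
    case (Suc k)
    have "Poly_Mapping.single (Poly_Mapping.single p (Suc k)) (1::'k) =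
        witt_gen (Suc p) * Poly_Mapping.single (Poly_Mapping.single p k) 1"
      by (simp add: witt_gen_def mult_single flip: single_add)
    then show ?case using mult[OF gen[of "Suc p"] Suc] by simp
  qed (use one in simp)
  have mon: "P (Poly_Mapping.single m 1)" for m
  proof -
    have "P (Poly_Mapping.single (\<Sum>p\<in>A. Poly_Mapping.single p (Poly_Mapping.lookup m p)) 1)"
      if "finite A" for A
      using that
    proof (induction A)
      case (insert p A)
      from mult[OF var[of p "Poly_Mapping.lookup m p"] insert.IH] insert.hyps
      show ?case by (simp add: mult_single)
    qed (use one in simp)
    moreover have "m = (\<Sum>p\<in>Poly_Mapping.keys m. Poly_Mapping.single p (Poly_Mapping.lookup m p))"
      by (rule poly_mapping_eqI)
        (simp add: lookup_sum lookup_single when_def in_keys_iff sum.delta)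
    ultimately show ?thesis by (metis finite_keys)
  qed
  have monom: "P (Poly_Mapping.single m c)" for m c
    using mult[OF const[of c] mon[of m]] by (simp add: witt_const_def mult_single)
  have "P (\<Sum>m\<in>A. Poly_Mapping.single m (Poly_Mapping.lookup f m))" if "finite A" for A
    using that by (induction A) (simp_all add: zero add monom)
  then show ?thesis using witt_poly_sum_monomials[of f] by (metis finite_keys)
qed

theorem witt_bracket_unique:
  fixes B :: "'k::field witt_poly \<Rightarrow> 'k witt_poly \<Rightarrow> 'k witt_poly"
  assumes add_left: "\<And>f g h. B (f + g) h = B f h + B g h"
    and add_right: "\<And>f g h. B h (f + g) = B h f + B h g"
    and smult_left: "\<And>c f h. B (witt_const c * f) h = witt_const c * B f h"
    and smult_right: "\<And>c f h. B h (witt_const c * f) = witt_const c * B h f"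
    and mult_left: "\<And>f g h. B (f * g) h = f * B g h + B f h * g"
    and mult_right: "\<And>f g h. B h (f * g) = f * B h g + B h f * g"
    and gen: "\<And>i j. i \<ge> 1 \<Longrightarrow> j \<ge> 1 \<Longrightarrow>
      B (witt_gen i) (witt_gen j) = witt_const (of_int (int j - int i)) * witt_gen (i + j)"
  shows "B = witt_bracket"
proof -
  have const_left: "D (witt_const c) h = 0"
    if "\<And>f g h. D (f * g) h = f * D g h + D f h * g"
      and "\<And>c f h. D (witt_const c * f) h = witt_const c * D f h"
    for D :: "'k witt_poly \<Rightarrow> 'k witt_poly \<Rightarrow> 'k witt_poly" and c h
  proof -
    have "D 1 h + D 1 h = D 1 h" using that(1)[of 1 1 h] by (simp only: mult_1 mult_1_right)
    then have "D 1 h = 0" by (metis add_cancel_right_right)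
    then show ?thesis using that(2)[of c 1 h] by simp
  qed
  have const_right: "D h (witt_const c) = 0"
    if "\<And>f g h. D h (f * g) = f * D h g + D h f * g"
      and "\<And>c f h. D h (witt_const c * f) = witt_const c * D h f"
    for D :: "'k witt_poly \<Rightarrow> 'k witt_poly \<Rightarrow> 'k witt_poly" and c h
  proof -
    have "D h 1 + D h 1 = D h 1" using that(1)[of h 1 1] by (simp only: mult_1 mult_1_right)
    then have "D h 1 = 0" by (metis add_cancel_right_right)
    then show ?thesis using that(2)[of h c 1] by simp
  qed
  have *: "B (witt_gen i) g = witt_bracket (witt_gen i) g" if "i \<ge> 1" for i g
  proof (induction g rule: witt_poly_induct)
    case (const c)
    show ?case
      using const_right[of B "witt_gen i" c, OF mult_right smult_right]
        const_right[of witt_bracket "witt_gen i" c, OF witt_bracket_mult_right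
          witt_bracket_smult_right]
      by (simp only:)
  next
    case (gen n)
    then show ?case using that by (simp add: assms(7) witt_bracket_gen)
  qed (simp_all add: add_right mult_right witt_bracket_add_right witt_bracket_mult_right)
  have "B f g = witt_bracket f g" for f g
  proof (induction f rule: witt_poly_induct)
    case (const c)
    show ?case
      using const_left[of B c g, OF mult_left smult_left]
        const_left[of witt_bracket c g, OF witt_bracket_mult_left witt_bracket_smult_left]
      by (simp only:)
  qed (simp_all add: * add_left mult_left witt_bracket_add_left witt_bracket_mult_left)
  then show ?thesis by (intro ext)
qed


subsection \<open>The quotient by an ideal is an algebra\<close>

lemma algebra_quot_algebra:
  fixes R (structure) and A (structure)
  assumes "algebra R A" and "ideal I A"
  shows "algebra R (quot_algebra A I)"
proof -
  interpret algebra R A by fact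
  interpret I: ideal I A by fact
  interpret Q: cring "A Quot I"
    by (rule I.quotient_is_cring[OF M_cring])
  let ?Q = "quot_algebra A I"
  have sm1: "c \<odot>\<^bsub>A\<^esub> x = (c \<odot>\<^bsub>A\<^esub> \<one>\<^bsub>A\<^esub>) \<otimes>\<^bsub>A\<^esub> x" if "c \<in> carrier R" "x \<in> carrier A" for c x
    using that smult_assoc2[of c "\<one>\<^bsub>A\<^esub>" x] by simp
  have smI: "c \<odot>\<^bsub>A\<^esub> x \<in> I" if "c \<in> carrier R" "x \<in> I" for c x
    using that sm1[of c x] I.I_l_closed[of x "c \<odot>\<^bsub>A\<^esub> \<one>\<^bsub>A\<^esub>"] by (simp add: I.a_subset[THEN subsetD])
  have sm: "c \<odot>\<^bsub>?Q\<^esub> (I +>\<^bsub>A\<^esub> x) = I +>\<^bsub>A\<^esub> (c \<odot>\<^bsub>A\<^esub> x)" if c: "c \<in> carrier R" and x: "x \<in> carrier A" for c x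
  proof -
    have *: "I +>\<^bsub>A\<^esub> (c \<odot>\<^bsub>A\<^esub> y) = I +>\<^bsub>A\<^esub> (c \<odot>\<^bsub>A\<^esub> x)" if y: "y \<in> I +>\<^bsub>A\<^esub> x" for y
    proof -
      obtain i where i: "i \<in> I" "y = i \<oplus>\<^bsub>A\<^esub> x"
        using y by (auto simp: a_r_coset_def')
      then have "c \<odot>\<^bsub>A\<^esub> y = c \<odot>\<^bsub>A\<^esub> i \<oplus>\<^bsub>A\<^esub> c \<odot>\<^bsub>A\<^esub> x"
        using c x by (simp add: smult_r_distr I.a_subset[THEN subsetD])
      then have "c \<odot>\<^bsub>A\<^esub> y \<in> I +>\<^bsub>A\<^esub> (c \<odot>\<^bsub>A\<^esub> x)"
        using smI[OF c i(1)] by (auto simp: a_r_coset_def')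
      then show ?thesis
        using c x by (metis M.a_repr_independence smult_closed I.a_subgroup)
    qed
    have "c \<odot>\<^bsub>?Q\<^esub> (I +>\<^bsub>A\<^esub> x) = (\<Union>y\<in>I +>\<^bsub>A\<^esub> x. I +>\<^bsub>A\<^esub> (c \<odot>\<^bsub>A\<^esub> y))"
      by (simp add: quot_algebra_def)
    also have "\<dots> = (\<Union>y\<in>I +>\<^bsub>A\<^esub> x. I +>\<^bsub>A\<^esub> (c \<odot>\<^bsub>A\<^esub> x))"
      by (rule SUP_cong[OF refl *])
    also have "\<dots> = I +>\<^bsub>A\<^esub> (c \<odot>\<^bsub>A\<^esub> x)"
      using I.a_rcos_self[OF x] by blast
    finally show ?thesis .
  qed
  have Qsimps: "carrier ?Q = carrier (A Quot I)" "mult ?Q = mult (A Quot I)"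
    "one ?Q = one (A Quot I)" "zero ?Q = zero (A Quot I)" "add ?Q = add (A Quot I)"
    by (simp_all add: quot_algebra_def)
  have rep: "\<exists>x\<in>carrier A. X = I +>\<^bsub>A\<^esub> x" if "X \<in> carrier ?Q" for X
    using that by (auto simp: Qsimps FactRing_def A_RCOSETS_def')
  have cl: "I +>\<^bsub>A\<^esub> x \<in> carrier ?Q" if "x \<in> carrier A" for x
    using that by (auto simp: Qsimps FactRing_def A_RCOSETS_def')
  have ad: "(I +>\<^bsub>A\<^esub> x) \<oplus>\<^bsub>?Q\<^esub> (I +>\<^bsub>A\<^esub> y) = I +>\<^bsub>A\<^esub> (x \<oplus>\<^bsub>A\<^esub> y)"
    if "x \<in> carrier A" "y \<in> carrier A" for x y
    using that by (simp add: Qsimps FactRing_def I.a_rcos_sum)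
  have mu: "(I +>\<^bsub>A\<^esub> x) \<otimes>\<^bsub>?Q\<^esub> (I +>\<^bsub>A\<^esub> y) = I +>\<^bsub>A\<^esub> (x \<otimes>\<^bsub>A\<^esub> y)"
    if "x \<in> carrier A" "y \<in> carrier A" for x y
    using that by (simp add: Qsimps FactRing_def I.rcoset_mult_add)
  have "cring ?Q"
  proof (rule cringI)
    show "abelian_group ?Q"
    proof (rule abelian_groupI, unfold Qsimps)
      fix X assume "X \<in> carrier (A Quot I)"
      then show "\<exists>Y\<in>carrier (A Quot I). Y \<oplus>\<^bsub>A Quot I\<^esub> X = \<zero>\<^bsub>A Quot I\<^esub>"
        using Q.a_inv_closed Q.l_neg by (rule_tac bexI)
    qed (simp_all add: Q.add.m_assoc Q.add.m_comm Q.add.m_lcomm)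
    show "comm_monoid ?Q"
      by (rule comm_monoidI, unfold Qsimps) (simp_all add: Q.m_assoc Q.m_comm Q.m_lcomm)
  qed (simp add: Qsimps Q.l_distr)
  show ?thesis
  proof (rule algebraI[OF R_cring \<open>cring ?Q\<close>])
    fix a X assume "a \<in> carrier R" "X \<in> carrier ?Q"
    then show "a \<odot>\<^bsub>?Q\<^esub> X \<in> carrier ?Q"
      by (auto dest!: rep simp: sm cl)
  next
    fix a b X assume "a \<in> carrier R" "b \<in> carrier R" "X \<in> carrier ?Q"
    then show "(a \<oplus>\<^bsub>R\<^esub> b) \<odot>\<^bsub>?Q\<^esub> X = a \<odot>\<^bsub>?Q\<^esub> X \<oplus>\<^bsub>?Q\<^esub> b \<odot>\<^bsub>?Q\<^esub> X"
      by (auto dest!: rep simp: sm ad smult_l_distr)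
  next
    fix a X Y assume "a \<in> carrier R" "X \<in> carrier ?Q" "Y \<in> carrier ?Q"
    then show "a \<odot>\<^bsub>?Q\<^esub> (X \<oplus>\<^bsub>?Q\<^esub> Y) = a \<odot>\<^bsub>?Q\<^esub> X \<oplus>\<^bsub>?Q\<^esub> a \<odot>\<^bsub>?Q\<^esub> Y"
      by (auto dest!: rep simp: sm ad smult_r_distr)
  next
    fix a b X assume "a \<in> carrier R" "b \<in> carrier R" "X \<in> carrier ?Q"
    then show "(a \<otimes>\<^bsub>R\<^esub> b) \<odot>\<^bsub>?Q\<^esub> X = a \<odot>\<^bsub>?Q\<^esub> (b \<odot>\<^bsub>?Q\<^esub> X)"
      by (auto dest!: rep simp: sm smult_assoc1)
  next
    fix X assume "X \<in> carrier ?Q"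
    then show "\<one>\<^bsub>R\<^esub> \<odot>\<^bsub>?Q\<^esub> X = X"
      by (auto dest!: rep simp: sm)
  next
    fix a X Y assume "a \<in> carrier R" "X \<in> carrier ?Q" "Y \<in> carrier ?Q"
    then show "(a \<odot>\<^bsub>?Q\<^esub> X) \<otimes>\<^bsub>?Q\<^esub> Y = a \<odot>\<^bsub>?Q\<^esub> (X \<otimes>\<^bsub>?Q\<^esub> Y)"
      by (auto dest!: rep simp: sm mu smult_assoc2)
  qed
qed

lemma algebra_witt_sym: "algebra (class_ring :: 'k::field ring) witt_sym"
proof (rule algebraI)
  show "cring (class_ring :: 'k ring)"
    by (unfold_locales) (auto simp: algebra_simps Units_def intro: exI[of _ "- _"])
  show "cring (witt_sym :: ('k, 'k witt_poly) module)"
    by (unfold_locales)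
      (auto simp: witt_sym_def algebra_simps Units_def intro: exI[of _ "- _"])
qed (auto simp: witt_sym_def witt_const_def algebra_simps single_add mult_single)

end

theory Submission
  imports Defs
begin

text \<open>
  Let \<open>f \<in> K\<close> be nonzero with last variable \<open>x\<^sub>T\<close>, and \<open>g = \<partial>f/\<partial>x\<^sub>T\<close>.  For \<open>n > T\<close> the bracket \<open>{f, x\<^sub>n}\<close>
  involves \<open>x\<^bsub>n+T\<^esub>\<close> linearly with coefficient a nonzero multiple of \<open>g\<close>, so after inverting \<open>g\<close> the
  quotient by \<open>K\<close> is generated by \<open>x\<^sub>1, \<dots>, x\<^bsub>2T\<^esub>\<close>.  Hence only finitely many minimal primes avoid \<open>g\<close>,
  and any \<open>2T + 1\<close> variables satisfy a relation modulo the ideal \<open>(R : g)\<close>, where \<open>R\<close> is the radical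
  of \<open>K\<close>.  In characteristic zero \<open>R\<close> and \<open>K' = (R : (R : g))\<close> are again Poisson ideals; \<open>K'\<close> contains
  the element \<open>g\<close> of smaller degree, every minimal prime over \<open>K\<close> that contains \<open>g\<close> is minimal over \<open>K'\<close>,
  and the product of \<open>(R : g)\<close> and \<open>K'\<close> lies in \<open>R\<close>.  By induction on the degree, the number of minimal
  primes is finite and there is a \<open>D\<close> such that any \<open>D + 1\<close> variables satisfy a polynomial relation
  modulo \<open>K\<close>.  The leading monomials of these relations force a standard monomial to have at most \<open>D\<close>
  large exponents, so the Gelfand-Kirillov dimension is finite.
\<close>

section \<open>Polynomials of bounded degree in given variables\<close>

definition mon_deg :: "(nat \<Rightarrow>\<^sub>0 nat) \<Rightarrow> nat" where
  "mon_deg m = (\<Sum>p\<in>Poly_Mapping.keys m. Poly_Mapping.lookup m p)"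

lemma mon_deg_superset:
  assumes "finite A" "Poly_Mapping.keys m \<subseteq> A"
  shows "mon_deg m = (\<Sum>p\<in>A. Poly_Mapping.lookup m p)"
  unfolding mon_deg_def
  by (rule sum.mono_neutral_left) (use assms in \<open>auto simp: in_keys_iff\<close>)

lemma keys_add_nat:
  fixes m n :: "nat \<Rightarrow>\<^sub>0 nat"
  shows "Poly_Mapping.keys (m + n) = Poly_Mapping.keys m \<union> Poly_Mapping.keys n"
  by (auto simp: in_keys_iff lookup_add)

lemma mon_deg_add: "mon_deg (m + n) = mon_deg m + mon_deg n"
  by (simp add: mon_deg_superset[of "Poly_Mapping.keys m \<union> Poly_Mapping.keys n"] keys_add_nat
      lookup_add sum.distrib)

lemma mon_deg_0 [simp]: "mon_deg 0 = 0"
  by (simp add: mon_deg_def)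

lemma mon_deg_single [simp]: "mon_deg (Poly_Mapping.single p k) = k"
  by (simp add: mon_deg_def)

lemma mon_deg_eq_0_iff: "mon_deg m = 0 \<longleftrightarrow> m = 0"
  by (auto simp: mon_deg_def in_keys_iff intro!: poly_mapping_eqI)

lemma lookup_le_mon_deg: "Poly_Mapping.lookup m p \<le> mon_deg m"
proof (cases "p \<in> Poly_Mapping.keys m")
  case True
  then show ?thesis unfolding mon_deg_def by (intro member_le_sum) auto
qed (simp add: in_keys_iff)

lemma diff_single_add_single:
  assumes "p \<in> Poly_Mapping.keys (m :: nat \<Rightarrow>\<^sub>0 nat)"
  shows "(m - Poly_Mapping.single p 1) + Poly_Mapping.single p 1 = m"
  using assms
  by (intro poly_mapping_eqI) (auto simp: lookup_add lookup_minus lookup_single when_def in_keys_iff)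

section \<open>Counting exponent vectors\<close>

text \<open>Restriction to \<open>B\<close> identifies these exponent vectors with the functions in
  \<open>PiE B (\<lambda>p. {..s p})\<close>. The bound depends on the position because standard
  monomials will be allowed large exponents at a few positions only.\<close>

lemma finite_bounded_monomials:
  fixes s :: "nat \<Rightarrow> nat"
  assumes "finite B"
  shows "finite {m. Poly_Mapping.keys m \<subseteq> B \<and> (\<forall>p\<in>B. Poly_Mapping.lookup m p \<le> s p)}" (is "finite ?M")
    and "card {m. Poly_Mapping.keys m \<subseteq> B \<and> (\<forall>p\<in>B. Poly_Mapping.lookup m p \<le> s p)}
      = (\<Prod>p\<in>B. s p + 1)"
proof -
  have "bij_betw (\<lambda>m. restrict (Poly_Mapping.lookup m) B) ?M (PiE B (\<lambda>p. {..s p}))"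
  proof (rule bij_betwI[where g = "\<lambda>u. Abs_poly_mapping (\<lambda>p. if p \<in> B then u p else 0)"])
    have fin: "finite {p. (if p \<in> B then u p else 0) \<noteq> (0::nat)}" for u
      by (rule finite_subset[OF _ assms]) auto
    note lk = lookup_Abs_poly_mapping[OF fin]
    show "(\<lambda>u. Abs_poly_mapping (\<lambda>p. if p \<in> B then u p else 0)) \<in> (PiE B (\<lambda>p. {..s p})) \<rightarrow> ?M"
      by (auto simp: lk in_keys_iff split: if_splits)
    fix m assume "m \<in> ?M"
    then show "Abs_poly_mapping (\<lambda>p. if p \<in> B then restrict (Poly_Mapping.lookup m) B p else 0) = m"
      by (intro poly_mapping_eqI) (auto simp: lk in_keys_iff)
  next
    have fin: "finite {p. (if p \<in> B then u p else 0) \<noteq> (0::nat)}" for u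
      by (rule finite_subset[OF _ assms]) auto
    note lk = lookup_Abs_poly_mapping[OF fin]
    fix u assume "u \<in> PiE B (\<lambda>p. {..s p})"
    then show "restrict (Poly_Mapping.lookup
        (Abs_poly_mapping (\<lambda>p. if p \<in> B then u p else 0))) B = u"
      by (auto simp: lk PiE_def extensional_def)
  qed auto
  then show "finite ?M" "card ?M = (\<Prod>p\<in>B. s p + 1)"
    using assms by (auto simp: bij_betw_finite bij_betw_same_card card_PiE finite_PiE)
qed

lemma bounded_deg_monomials:
  assumes "finite B"
  shows "finite {m. Poly_Mapping.keys m \<subseteq> B \<and> mon_deg m \<le> d}" (is "finite ?M")
    and "card {m. Poly_Mapping.keys m \<subseteq> B \<and> mon_deg m \<le> d} \<le> (d + 1) ^ card B"
proof -
  have sub: "?M \<subseteq> {m. Poly_Mapping.keys m \<subseteq> B \<and> (\<forall>p\<in>B. Poly_Mapping.lookup m p \<le> d)}"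
    using lookup_le_mon_deg order.trans by blast
  show "finite ?M"
    by (rule finite_subset[OF sub finite_bounded_monomials(1)[OF assms]])
  show "card ?M \<le> (d + 1) ^ card B"
    using card_mono[OF finite_bounded_monomials(1)[OF assms] sub]
      finite_bounded_monomials(2)[OF assms, of "\<lambda>_. d"] by simp
qed

text \<open>The degree filtration of the polynomial ring in the variables of \<open>B\<close>. With
  \<open>B = UNIV\<close> it bounds the total degree alone, which is the measure of the main
  induction.\<close>

definition poly_space :: "nat \<Rightarrow> nat set \<Rightarrow> 'k::field witt_poly set" where
  "poly_space d B = {f. \<forall>m\<in>Poly_Mapping.keys f. Poly_Mapping.keys m \<subseteq> B \<and> mon_deg m \<le> d}"

lemma poly_space_mono: "d \<le> e \<Longrightarrow> B \<subseteq> C \<Longrightarrow> poly_space d B \<subseteq> poly_space e C"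
  by (force simp: poly_space_def)

lemma poly_space_0 [simp]: "0 \<in> poly_space d B"
  by (simp add: poly_space_def)

lemma poly_space_add: "f \<in> poly_space d B \<Longrightarrow> g \<in> poly_space d B \<Longrightarrow> f + g \<in> poly_space d B"
  using keys_add[of f g] by (auto simp: poly_space_def)

lemma poly_space_sum: "(\<And>a. a \<in> A \<Longrightarrow> h a \<in> poly_space d B) \<Longrightarrow> sum h A \<in> poly_space d B"
  by (induction A rule: infinite_finite_induct) (auto intro: poly_space_add)

lemma poly_space_mult:
  assumes "f \<in> poly_space d B" "g \<in> poly_space e B"
  shows "f * g \<in> poly_space (d + e) B"
  unfolding poly_space_def
proof (intro CollectI ballI)
  fix m assume "m \<in> Poly_Mapping.keys (f * g)"
  then obtain a b where "m = a + b" "a \<in> Poly_Mapping.keys f" "b \<in> Poly_Mapping.keys g"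
    using keys_mult[of f g] by auto
  then show "Poly_Mapping.keys m \<subseteq> B \<and> mon_deg m \<le> d + e"
    using assms by (auto simp: poly_space_def mon_deg_add keys_add_nat add_mono)
qed

lemma poly_space_single:
  "Poly_Mapping.keys m \<subseteq> B \<Longrightarrow> mon_deg m \<le> d \<Longrightarrow> Poly_Mapping.single m c \<in> poly_space d B"
  by (simp add: poly_space_def)

lemma poly_space_const: "witt_const c \<in> poly_space d B"
  by (simp add: witt_const_def poly_space_single)

lemma poly_space_1: "1 \<in> poly_space d B"
  using poly_space_const[of 1] by (simp add: witt_const_def)

lemma poly_space_smult: "f \<in> poly_space d B \<Longrightarrow> witt_const c * f \<in> poly_space d B"
  using poly_space_mult[OF poly_space_const[of c 0]] by simp

lemma poly_space_gen: "p \<in> B \<Longrightarrow> witt_gen (p + 1) \<in> poly_space 1 B"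
  by (simp add: witt_gen_def poly_space_single)

lemma poly_space_power: "f \<in> poly_space d B \<Longrightarrow> f ^ k \<in> poly_space (k * d) B"
  by (induction k) (auto simp: poly_space_1 intro: poly_space_mult)

text \<open>A term with nonzero derivative contains the variable \<open>p\<close> and loses one
  degree. For \<open>d = 0\<close> there is no such term, so the truncated difference
  \<open>d - 1\<close> is harmless.\<close>

lemma poly_space_pderiv:
  assumes "f \<in> poly_space d B"
  shows "witt_pderiv p f \<in> poly_space (d - 1) B"
  unfolding witt_pderiv_def
proof (rule poly_space_sum)
  fix m assume m: "m \<in> Poly_Mapping.keys f"
  show "Poly_Mapping.single (m - Poly_Mapping.single p 1)
      (of_nat (Poly_Mapping.lookup m p) * Poly_Mapping.lookup f m) \<in> poly_space (d - 1) B"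
  proof (cases "p \<in> Poly_Mapping.keys m")
    case True
    from diff_single_add_single[OF True] have "mon_deg (m - Poly_Mapping.single p 1) + 1 = mon_deg m"
      by (metis mon_deg_add mon_deg_single)
    moreover have "Poly_Mapping.keys (m - Poly_Mapping.single p 1) \<subseteq> Poly_Mapping.keys m"
      by (auto simp: in_keys_iff lookup_minus)
    ultimately show ?thesis
      using assms m by (intro poly_space_single) (force simp: poly_space_def)+
  qed (simp add: in_keys_iff)
qed

lemma poly_space_iff_vars: "f \<in> poly_space d B \<longleftrightarrow> f \<in> poly_space d UNIV \<and> witt_vars f \<subseteq> B"
  by (auto simp: poly_space_def witt_vars_def)

lemma poly_space_exists:
  obtains d where "f \<in> poly_space d (witt_vars f)"
proof
  show "f \<in> poly_space (Max (insert 0 (mon_deg ` Poly_Mapping.keys f))) (witt_vars f)"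
    by (auto simp: poly_space_def witt_vars_def)
qed

lemma poly_space_no_vars:
  assumes "witt_vars f = {}"
  obtains c where "f = witt_const c"
proof
  have "m = 0" if "m \<in> Poly_Mapping.keys f" for m
    using assms that by (auto simp: witt_vars_def)
  then show "f = witt_const (Poly_Mapping.lookup f 0)"
    by (intro poly_mapping_eqI)
      (auto simp: witt_const_def lookup_single when_def in_keys_iff)
qed

text \<open>Lowering the exponent of \<open>p\<close> is injective on the monomials that contain
  \<open>p\<close>, so nothing cancels, and in characteristic zero the exponent is a nonzero
  factor.\<close>

lemma witt_pderiv_neq_0:
  fixes f :: "'k::field_char_0 witt_poly"
  assumes "p \<in> witt_vars f"
  shows "witt_pderiv p f \<noteq> 0"
proof -
  let ?e = "Poly_Mapping.single p (1::nat)"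
  from assms obtain m where m: "m \<in> Poly_Mapping.keys f" "p \<in> Poly_Mapping.keys m"
    by (auto simp: witt_vars_def)
  have "Poly_Mapping.lookup (witt_pderiv p f) (m - ?e) =
      (\<Sum>n\<in>Poly_Mapping.keys f. of_nat (Poly_Mapping.lookup n p) * Poly_Mapping.lookup f n
        when n - ?e = m - ?e)"
    by (simp add: witt_pderiv_def lookup_sum lookup_single)
  also have "\<dots> = (\<Sum>n\<in>Poly_Mapping.keys f. if n = m then
        of_nat (Poly_Mapping.lookup m p) * Poly_Mapping.lookup f m else 0)"
  proof (intro sum.cong refl)
    fix n
    have "n = m" if "n - ?e = m - ?e" "Poly_Mapping.lookup n p \<noteq> 0"
      using diff_single_add_single[of p n] diff_single_add_single[OF m(2)] that
      by (metis in_keys_iff)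
    then show "(of_nat (Poly_Mapping.lookup n p) * Poly_Mapping.lookup f n when n - ?e = m - ?e)
        = (if n = m then of_nat (Poly_Mapping.lookup m p) * Poly_Mapping.lookup f m else 0)"
      by (auto simp: when_def)
  qed
  also have "\<dots> \<noteq> 0" using m by (simp add: in_keys_iff)
  finally show ?thesis by force
qed

section \<open>Ideals and prime ideals\<close>

lemma cring_witt_sym: "cring (witt_sym :: ('k::field, 'k witt_poly) module)"
  using algebra_witt_sym by (rule algebra.axioms(2))

text \<open>This replaces the locale \<open>ideal\<close> by closure conditions in the operations of
  the type class. Negatives come from multiplication by \<open>- 1\<close>.\<close>

lemma ideal_witt_sym_iff:
  "ideal I witt_sym \<longleftrightarrow> 0 \<in> I \<and> (\<forall>a\<in>I. \<forall>b\<in>I. a + b \<in> I) \<and> (\<forall>a\<in>I. \<forall>x. x * a \<in> I)"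
  for I :: "'k::field witt_poly set"
proof -
  interpret cring "witt_sym :: ('k, 'k witt_poly) module" by (rule cring_witt_sym)
  have s: "carrier (witt_sym :: ('k, 'k witt_poly) module) = UNIV"
    "mult (witt_sym :: ('k, 'k witt_poly) module) = (*)"
    "add (witt_sym :: ('k, 'k witt_poly) module) = (+)"
    "zero (witt_sym :: ('k, 'k witt_poly) module) = 0"
    by (auto simp: witt_sym_def)
  show ?thesis
  proof
    assume "ideal I witt_sym"
    then interpret I: ideal I "witt_sym :: ('k, 'k witt_poly) module" .
    show "0 \<in> I \<and> (\<forall>a\<in>I. \<forall>b\<in>I. a + b \<in> I) \<and> (\<forall>a\<in>I. \<forall>x. x * a \<in> I)"
      using I.zero_closed I.a_closed I.I_l_closed by (simp add: s)
  next
    assume *: "0 \<in> I \<and> (\<forall>a\<in>I. \<forall>b\<in>I. a + b \<in> I) \<and> (\<forall>a\<in>I. \<forall>x. x * a \<in> I)"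
    have neg: "\<ominus>\<^bsub>witt_sym\<^esub> a = - a" for a :: "'k witt_poly"
      by (rule minus_equality) (auto simp: s)
    have "\<ominus>\<^bsub>witt_sym\<^esub> a \<in> I" if "a \<in> I" for a :: "'k witt_poly"
    proof -
      have "(- 1) * a \<in> I" using * that by blast
      then show ?thesis using neg[of a] by simp
    qed
    then show "ideal I witt_sym"
      using * by (intro idealI ring_axioms add.subgroupI)
        (auto simp: s mult.commute simp flip: a_inv_def)
  qed
qed

lemma ideal_witt_sym_0: "ideal I witt_sym \<Longrightarrow> (0 :: 'k::field witt_poly) \<in> I"
  and ideal_witt_sym_add:
    "ideal I witt_sym \<Longrightarrow> a \<in> I \<Longrightarrow> b \<in> I \<Longrightarrow> (a + b :: 'k::field witt_poly) \<in> I"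
  and ideal_witt_sym_mult:
    "ideal I witt_sym \<Longrightarrow> a \<in> I \<Longrightarrow> (x * a :: 'k::field witt_poly) \<in> I"
  by (auto simp: ideal_witt_sym_iff)

lemma ideal_witt_sym_mult_right:
  "ideal I witt_sym \<Longrightarrow> a \<in> I \<Longrightarrow> (a * x :: 'k::field witt_poly) \<in> I"
  by (subst mult.commute) (rule ideal_witt_sym_mult)

lemma ideal_witt_sym_minus:
  "ideal I witt_sym \<Longrightarrow> a \<in> I \<Longrightarrow> (- a :: 'k::field witt_poly) \<in> I"
  using ideal_witt_sym_mult[of I a "- 1"] by simp

lemma ideal_witt_sym_diff:
  "ideal I witt_sym \<Longrightarrow> a \<in> I \<Longrightarrow> b \<in> I \<Longrightarrow> (a - b :: 'k::field witt_poly) \<in> I"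
  using ideal_witt_sym_add[of I a "- b"] ideal_witt_sym_minus[of I b] by simp

lemma ideal_witt_sym_sum:
  "ideal I witt_sym \<Longrightarrow> (\<And>a. a \<in> A \<Longrightarrow> h a \<in> I) \<Longrightarrow> (sum h A :: 'k::field witt_poly) \<in> I"
  by (induction A rule: infinite_finite_induct)
    (auto intro: ideal_witt_sym_0 ideal_witt_sym_add)

lemma ideal_witt_sym_eq_UNIV:
  assumes "ideal I witt_sym" "witt_const c \<in> I" "c \<noteq> (0 :: 'k::field)"
  shows "I = UNIV"
proof -
  have "witt_const (1 / c) * witt_const c = (1 :: 'k witt_poly)"
    using assms(3) by (simp add: witt_const_def mult_single)
  then have "1 \<in> I" using ideal_witt_sym_mult[OF assms(1,2)] by metis
  then show ?thesis using ideal_witt_sym_mult_right[OF assms(1)] by (metis UNIV_eq_I mult_1)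
qed

lemma primeideal_witt_sym_iff:
  "primeideal P witt_sym \<longleftrightarrow>
    ideal P witt_sym \<and> 1 \<notin> P \<and> (\<forall>a b. a * b \<in> P \<longrightarrow> a \<in> P \<or> b \<in> P)"
  for P :: "'k::field witt_poly set"
proof -
  interpret cring "witt_sym :: ('k, 'k witt_poly) module" by (rule cring_witt_sym)
  have "P = UNIV" if "ideal P witt_sym" "1 \<in> P"
    using ideal_witt_sym_mult[OF that] by (metis UNIV_eq_I mult_1_right)
  then show ?thesis
    by (auto simp: primeideal_def primeideal_axioms_def cring_axioms)
      (auto simp: witt_sym_def)
qed

lemma prime_power_mem:
  assumes "primeideal P witt_sym" "x ^ n \<in> P"
  shows "(x :: 'k::field witt_poly) \<in> P"
  using assms by (induction n) (auto simp: primeideal_witt_sym_iff)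

section \<open>Existence of primes by Zorn's lemma, and localization at a minimal prime\<close>

text \<open>An ideal that is maximal among those containing \<open>K\<close> and disjoint from the
  multiplicative set \<open>M\<close> is prime.\<close>

lemma prime_avoiding_exists:
  fixes K M :: "'k::field witt_poly set"
  assumes K: "ideal K witt_sym" and one: "1 \<in> M"
    and mult: "\<And>a b. a \<in> M \<Longrightarrow> b \<in> M \<Longrightarrow> a * b \<in> M" and disj: "K \<inter> M = {}"
  obtains Q where "primeideal Q witt_sym" "K \<subseteq> Q" "Q \<inter> M = {}"
proof -
  define F where "F = {I. ideal I witt_sym \<and> K \<subseteq> I \<and> I \<inter> M = {}}"
  have "\<exists>Q\<in>F. \<forall>I\<in>F. Q \<subseteq> I \<longrightarrow> I = Q"
  proof (rule subset_Zorn_nonempty)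
    show "F \<noteq> {}" using K disj by (auto simp: F_def)
    fix C assume C: "C \<noteq> {}" "subset.chain F C"
    then have CF: "C \<subseteq> F" and lin: "\<And>X Y. X \<in> C \<Longrightarrow> Y \<in> C \<Longrightarrow> X \<subseteq> Y \<or> Y \<subseteq> X"
      by (auto simp: subset_chain_def)
    have id: "ideal X witt_sym" if "X \<in> C" for X
      using CF that by (auto simp: F_def)
    have "a + b \<in> \<Union>C" if ab: "a \<in> \<Union>C" "b \<in> \<Union>C" for a b
    proof -
      from ab obtain X Y where XY: "X \<in> C" "a \<in> X" "Y \<in> C" "b \<in> Y" by blast
      then obtain Z where Z: "Z \<in> C" "a \<in> Z" "b \<in> Z" using lin[of X Y] by blast
      then show ?thesis using ideal_witt_sym_add[OF id[OF Z(1)]] by blast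
    qed
    moreover have "x * a \<in> \<Union>C" if a: "a \<in> \<Union>C" for a x
    proof -
      from a obtain X where X: "X \<in> C" "a \<in> X" by blast
      then show ?thesis using ideal_witt_sym_mult[OF id[OF X(1)]] by blast
    qed
    moreover have "0 \<in> \<Union>C" using C(1) ideal_witt_sym_0[OF id] by blast
    ultimately have "ideal (\<Union>C) witt_sym"
      unfolding ideal_witt_sym_iff by blast
    then show "\<Union>C \<in> F" using C(1) CF by (auto simp: F_def)
  qed
  then obtain Q where QF: "Q \<in> F" and maxF: "\<And>I. I \<in> F \<Longrightarrow> Q \<subseteq> I \<Longrightarrow> I = Q"
    by blast
  from QF have Q: "ideal Q witt_sym" "K \<subseteq> Q" "Q \<inter> M = {}"
    by (auto simp: F_def)
  have max: "I = Q" if "ideal I witt_sym" "Q \<subseteq> I" "I \<inter> M = {}" for I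
    using maxF[of I] that Q(2) by (auto simp: F_def)
  \<comment> \<open>By maximality, the ideal generated by \<open>Q\<close> and an element outside
    \<open>Q\<close> must meet \<open>M\<close>.\<close>
  have meet: "\<exists>q r. q \<in> Q \<and> q + r * a \<in> M" if "a \<notin> Q" for a
  proof -
    let ?I = "{q + r * a | q r. q \<in> Q}"
    have "ideal ?I witt_sym"
      unfolding ideal_witt_sym_iff
    proof (intro conjI ballI allI)
      show "0 \<in> ?I" using ideal_witt_sym_0[OF Q(1)] by (intro CollectI exI[of _ 0]) simp
      fix u assume "u \<in> ?I"
      then obtain q r where u: "q \<in> Q" "u = q + r * a" by blast
      show "x * u \<in> ?I" for x
        using ideal_witt_sym_mult[OF Q(1) u(1), of x] u(2)
        by (intro CollectI exI[of _ "x * q"] exI[of _ "x * r"]) (simp add: algebra_simps)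
      fix v assume "v \<in> ?I"
      then obtain q' r' where v: "q' \<in> Q" "v = q' + r' * a" by blast
      show "u + v \<in> ?I"
        using ideal_witt_sym_add[OF Q(1) u(1) v(1)] u(2) v(2)
        by (intro CollectI exI[of _ "q + q'"] exI[of _ "r + r'"]) (simp add: algebra_simps)
    qed
    moreover have "Q \<subseteq> ?I"
    proof
      fix q assume "q \<in> Q"
      then show "q \<in> ?I" by (intro CollectI exI[of _ q] exI[of _ 0]) simp
    qed
    moreover have "a \<in> ?I"
      using ideal_witt_sym_0[OF Q(1)] by (intro CollectI exI[of _ 0] exI[of _ 1]) simp
    ultimately have "?I \<inter> M \<noteq> {}" using max[of ?I] that by blast
    then show ?thesis by blast
  qed
  have "a \<in> Q \<or> b \<in> Q" if ab: "a * b \<in> Q" for a b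
  proof (rule ccontr)
    assume "\<not> ?thesis"
    then have "a \<notin> Q" "b \<notin> Q" by auto
    then obtain q r q' r' where
      *: "q \<in> Q" "q + r * a \<in> M" "q' \<in> Q" "q' + r' * b \<in> M"
      using meet[of a] meet[of b] by blast
    \<comment> \<open>This is the product of the two elements of \<open>M\<close> written so that
      each summand has a factor \<open>q\<close>, \<open>q'\<close> or \<open>a * b\<close> from
      \<open>Q\<close>.\<close>
    have "(q' + r' * b) * q + r * a * q' + r * r' * (a * b) \<in> Q"
      using ideal_witt_sym_mult[OF Q(1)] *(1,3) ab by (intro ideal_witt_sym_add[OF Q(1)]) blast+
    then have "(q + r * a) * (q' + r' * b) \<in> Q" by (simp add: algebra_simps)
    moreover have "(q + r * a) * (q' + r' * b) \<in> M" by (rule mult[OF *(2,4)])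
    ultimately show False using Q(3) by blast
  qed
  then show ?thesis using that[of Q] Q one by (auto simp: primeideal_witt_sym_iff)
qed

text \<open>If \<open>K\<close> missed the multiplicative set of all \<open>g ^ a * y\<close> with
  \<open>y \<notin> P\<close>, a prime over \<open>K\<close> avoiding that set would lie in
  \<open>P\<close> without containing \<open>g\<close>, against minimality. In other words,
  \<open>g\<close> becomes nilpotent modulo \<open>K\<close> after localization at
  \<open>P\<close>.\<close>

lemma minimal_prime_nilpotent:
  fixes K :: "'k::field witt_poly set"
  assumes K: "ideal K witt_sym" and P: "minimal_prime_over witt_sym K P" and g: "g \<in> P"
  obtains y a where "y \<notin> P" "g ^ a * y \<in> K"
proof -
  have prime: "primeideal P witt_sym" and KP: "K \<subseteq> P"
    and min: "\<And>Q. primeideal Q witt_sym \<Longrightarrow> K \<subseteq> Q \<Longrightarrow> Q \<subseteq> P \<Longrightarrow> Q = P"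
    using P by (auto simp: minimal_prime_over_def)
  let ?M = "{g ^ a * y | a y. y \<notin> P}"
  have "K \<inter> ?M \<noteq> {}"
  proof
    assume "K \<inter> ?M = {}"
    moreover have "1 \<in> ?M"
      using prime by (intro CollectI exI[of _ 0] exI[of _ 1]) (simp add: primeideal_witt_sym_iff)
    moreover have "u * v \<in> ?M" if "u \<in> ?M" "v \<in> ?M" for u v
    proof -
      from that obtain a y b z where "u = g ^ a * y" "y \<notin> P" "v = g ^ b * z" "z \<notin> P" by blast
      then show ?thesis using prime
        by (intro CollectI exI[of _ "a + b"] exI[of _ "y * z"])
          (auto simp: primeideal_witt_sym_iff power_add mult_ac)
    qed
    ultimately obtain Q where Q: "primeideal Q witt_sym" "K \<subseteq> Q" "Q \<inter> ?M = {}"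
      using prime_avoiding_exists[OF K, of ?M] by blast
    have "y \<in> ?M" if "y \<notin> P" for y using that by (intro CollectI exI[of _ 0] exI[of _ y]) simp
    then have "Q \<subseteq> P" using Q(3) by blast
    then have "g \<in> Q" using min[OF Q(1,2)] g by blast
    moreover have "g \<in> ?M"
      using prime by (intro CollectI exI[of _ 1]) (auto simp: primeideal_witt_sym_iff)
    ultimately show False using Q(3) by blast
  qed
  then show ?thesis using that by blast
qed

section \<open>Radicals and colon ideals of Poisson ideals\<close>

text \<open>For an ideal \<open>K\<close> the exponent \<open>n = 0\<close> changes nothing: it
  qualifies only if \<open>1 \<in> K\<close>, and then all powers lie in \<open>K\<close>
  anyway.\<close>

definition rad :: "'k::field witt_poly set \<Rightarrow> 'k witt_poly set" where
  "rad K = {h. \<exists>n. h ^ n \<in> K}"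

lemma subset_rad: "K \<subseteq> rad K"
  by (auto simp: rad_def intro: exI[of _ 1])

lemma rad_power: "h ^ n \<in> rad K \<Longrightarrow> h \<in> rad K"
  by (auto simp: rad_def simp flip: power_mult)

lemma rad_square: "h * h \<in> rad K \<Longrightarrow> h \<in> rad K"
  using rad_power[of h 2] by (simp add: power2_eq_square)

lemma ideal_rad:
  assumes "ideal K witt_sym"
  shows "ideal (rad K) witt_sym"
  unfolding ideal_witt_sym_iff
proof (intro conjI ballI allI)
  show "0 \<in> rad K" using subset_rad ideal_witt_sym_0[OF assms] by blast
  fix a assume "a \<in> rad K"
  then obtain n where n: "a ^ n \<in> K" by (auto simp: rad_def)
  show "x * a \<in> rad K" for x
    using ideal_witt_sym_mult[OF assms n] by (auto simp: rad_def power_mult_distrib)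
  fix b assume "b \<in> rad K"
  then obtain m where m: "b ^ m \<in> K" by (auto simp: rad_def)
  have "(a + b) ^ (n + m) \<in> K"
    unfolding binomial_ring
  proof (rule ideal_witt_sym_sum[OF assms])
    fix k assume "k \<in> {..n + m}"
    consider "n \<le> k" | "m \<le> n + m - k" by linarith
    then show "of_nat (n + m choose k) * a ^ k * b ^ (n + m - k) \<in> K"
    proof cases
      case 1
      then have "a ^ k \<in> K"
        using ideal_witt_sym_mult[OF assms n, of "a ^ (k - n)"] by (simp flip: power_add)
      then show ?thesis by (intro ideal_witt_sym_mult ideal_witt_sym_mult_right assms)
    next
      case 2
      then have "b ^ (n + m - k) = b ^ (n + m - k - m) * b ^ m"
        by (metis le_add_diff_inverse2 power_add)
      then have "b ^ (n + m - k) \<in> K"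
        using ideal_witt_sym_mult[OF assms m] by simp
      then show ?thesis by (intro ideal_witt_sym_mult assms)
    qed
  qed
  then show "a + b \<in> rad K" by (auto simp: rad_def)
qed

lemma witt_bracket_power:
  "witt_bracket (h ^ Suc n) y = of_nat (Suc n) * h ^ n * witt_bracket h y"
proof (induction n)
  case (Suc n)
  have "witt_bracket (h * h ^ Suc n) y = h * witt_bracket (h ^ Suc n) y + witt_bracket h y * h ^ Suc n"
    by (rule witt_bracket_mult_left)
  with Suc show ?case by (simp add: algebra_simps)
qed simp

text \<open>Differentiating \<open>h\<^sup>n\<close> repeatedly trades each factor \<open>h\<close> for \<open>D(h)\<^sup>2\<close>; characteristic zero
  allows division by the exponents that come up.\<close>

lemma poisson_ideal_rad:
  fixes K :: "'k::field_char_0 witt_poly set"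
  assumes "witt_poisson_ideal K"
  shows "witt_poisson_ideal (rad K)"
  unfolding witt_poisson_ideal_def
proof (intro conjI ballI allI)
  have K: "ideal K witt_sym" and br: "\<And>f y. f \<in> K \<Longrightarrow> witt_bracket f y \<in> K"
    using assms by (auto simp: witt_poisson_ideal_def)
  show "ideal (rad K) witt_sym" by (rule ideal_rad[OF K])
  fix h y :: "'k witt_poly" assume "h \<in> rad K"
  then obtain n where n: "h ^ n \<in> K" by (auto simp: rad_def)
  define D where "D = (\<lambda>f. witt_bracket f y)"
  have "h ^ (n - k) * D h ^ (2 * k) \<in> K" if "k \<le> n" for k
    using that
  proof (induction k)
    case (Suc k)
    define j where "j = n - Suc k"
    have nk: "n - k = Suc j" using Suc.prems by (simp add: j_def)
    have IH: "h ^ Suc j * D h ^ (2 * k) \<in> K" using Suc by (simp add: nk)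
    \<comment> \<open>After multiplication by \<open>D h\<close>, the last summand of this Leibniz
      expansion is a multiple of the wanted element by the integer \<open>Suc j\<close>; the left
      side stays in \<open>K\<close> because \<open>K\<close> is Poisson.\<close>
    have "D (h ^ Suc j * D h ^ (2 * k)) =
      h ^ Suc j * D (D h ^ (2 * k)) + of_nat (Suc j) * h ^ j * D h * D h ^ (2 * k)"
      unfolding D_def witt_bracket_mult_left witt_bracket_power ..
    then have "of_nat (Suc j) * (h ^ j * D h ^ (2 * Suc k)) =
      D h * D (h ^ Suc j * D h ^ (2 * k)) - D h * (h ^ Suc j * D (D h ^ (2 * k)))"
      by (simp add: algebra_simps)
    \<comment> \<open>Differentiating the power of \<open>D h\<close> costs one factor
      \<open>D h\<close>, which the factor in front restores, so the induction hypothesis applies.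
      For \<open>k = 0\<close> there is no factor to extract, but then the derivative is that of
      \<open>1\<close>.\<close>
    moreover have "D h * (h ^ Suc j * D (D h ^ (2 * k))) \<in> K"
    proof (cases k)
      case 0
      have "D 1 = 0" using witt_bracket_mult_left[of 1 1 y] by (simp add: D_def)
      with 0 show ?thesis by (simp add: ideal_witt_sym_0[OF K])
    next
      case (Suc i)
      define E where "E = D h ^ (2 * i + 1)"
      have e: "D (D h ^ (2 * k)) = of_nat (2 * k) * E * D (D h)"
        using witt_bracket_power[of "D h" "2 * i + 1" y] Suc by (simp add: E_def D_def)
      have p: "D h ^ (2 * k) = D h * E" by (simp add: E_def Suc)
      have "D h * (h ^ Suc j * D (D h ^ (2 * k))) =
        of_nat (2 * k) * D (D h) * (h ^ Suc j * D h ^ (2 * k))"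
        unfolding e unfolding p by (simp only: mult_ac)
      then show ?thesis using ideal_witt_sym_mult[OF K IH] by metis
    qed
    ultimately have "of_nat (Suc j) * (h ^ j * D h ^ (2 * Suc k)) \<in> K"
      using ideal_witt_sym_diff[OF K] ideal_witt_sym_mult[OF K br[OF IH]] by (simp add: D_def)
    moreover have "witt_const (1 / of_nat (Suc j)) * (of_nat (Suc j) * x) = x" for x :: "'k witt_poly"
    proof -
      have "witt_const (1 / of_nat (Suc j)) * of_nat (Suc j) = (1 :: 'k witt_poly)"
        by (simp add: witt_const_def mult_single del: of_nat_Suc flip: single_of_nat)
      then show ?thesis by (metis mult.assoc mult_1)
    qed
    ultimately show ?case using ideal_witt_sym_mult[OF K] unfolding j_def by metis
  qed (use n in simp)
  from this[of n] have "D h ^ (2 * n) \<in> K" by simp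
  then show "witt_bracket h y \<in> rad K" by (auto simp: rad_def D_def)
qed

text \<open>The colon ideal \<open>(R : (R : g))\<close> for \<open>R = rad K\<close>.\<close>

definition bicolon :: "'k::field witt_poly set \<Rightarrow> 'k witt_poly \<Rightarrow> 'k witt_poly set" where
  "bicolon K g = {w. \<forall>u. g * u \<in> rad K \<longrightarrow> w * u \<in> rad K}"

lemma subset_bicolon: "ideal K witt_sym \<Longrightarrow> K \<subseteq> bicolon K g"
  using subset_rad[of K] by (auto simp: bicolon_def intro: ideal_witt_sym_mult_right[OF ideal_rad])

lemma mem_bicolon: "g \<in> bicolon K g"
  by (simp add: bicolon_def)

text \<open>For \<open>w * u \<in> rad K\<close>, the square of \<open>witt_bracket w y * u\<close>
  is a combination of \<open>witt_bracket (w * u) y\<close> and \<open>w * u\<close>. Both lie in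
  the Poisson ideal \<open>rad K\<close>, which is radical.\<close>

lemma poisson_ideal_bicolon:
  fixes K :: "'k::field_char_0 witt_poly set"
  assumes "witt_poisson_ideal K"
  shows "witt_poisson_ideal (bicolon K g)"
  unfolding witt_poisson_ideal_def
proof (intro conjI ballI allI)
  have R: "ideal (rad K) witt_sym" and br: "\<And>f y. f \<in> rad K \<Longrightarrow> witt_bracket f y \<in> rad K"
    using poisson_ideal_rad[OF assms] by (auto simp: witt_poisson_ideal_def)
  show "ideal (bicolon K g) witt_sym"
    unfolding ideal_witt_sym_iff bicolon_def
    by (auto simp: distrib_right mult.assoc
        intro: ideal_witt_sym_0[OF R] ideal_witt_sym_add[OF R] ideal_witt_sym_mult[OF R])
  fix w y assume w: "w \<in> bicolon K g"
  show "witt_bracket w y \<in> bicolon K g"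
    unfolding bicolon_def
  proof (intro CollectI allI impI)
    fix u assume "g * u \<in> rad K"
    then have wu: "w * u \<in> rad K" using w by (simp add: bicolon_def)
    let ?d = "witt_bracket w y * u"
    have "?d * ?d = (u * witt_bracket w y) * witt_bracket (w * u) y -
        (witt_bracket w y * witt_bracket u y) * (w * u)"
      by (simp add: witt_bracket_mult_left algebra_simps)
    also have "\<dots> \<in> rad K"
      by (intro ideal_witt_sym_diff[OF R] ideal_witt_sym_mult[OF R] br wu)
    finally show "?d \<in> rad K" by (rule rad_square)
  qed
qed

section \<open>Graded lexicographic order\<close>

text \<open>Ties in degree are broken by the library order on \<open>poly_mapping\<close>, which is
  total and compatible with addition. Comparing degrees first leaves only finitely many monomials in
  finitely many variables below a given one.\<close>

definition mon_less :: "(nat \<Rightarrow>\<^sub>0 nat) \<Rightarrow> (nat \<Rightarrow>\<^sub>0 nat) \<Rightarrow> bool" where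
  "mon_less m n \<longleftrightarrow> mon_deg m < mon_deg n \<or> mon_deg m = mon_deg n \<and> m < n"

lemma mon_less_irrefl: "\<not> mon_less m m"
  by (simp add: mon_less_def)

lemma mon_less_trans: "mon_less m n \<Longrightarrow> mon_less n l \<Longrightarrow> mon_less m l"
  by (auto simp: mon_less_def)

lemma mon_less_add: "mon_less m n \<Longrightarrow> mon_less (m + l) (n + l)"
  by (auto simp: mon_less_def mon_deg_add add_strict_right_mono)

lemma mon_less_deg: "mon_less m n \<Longrightarrow> mon_deg m \<le> mon_deg n"
  by (auto simp: mon_less_def)

definition leading_mon :: "'k::field witt_poly \<Rightarrow> (nat \<Rightarrow>\<^sub>0 nat) \<Rightarrow> bool" where
  "leading_mon f m \<longleftrightarrow>
    m \<in> Poly_Mapping.keys f \<and> (\<forall>n\<in>Poly_Mapping.keys f. n \<noteq> m \<longrightarrow> mon_less n m)"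

lemma leading_mon_exists:
  assumes "f \<noteq> 0"
  obtains m where "leading_mon f m"
proof -
  define d where "d = Max (mon_deg ` Poly_Mapping.keys f)"
  define A where "A = {m \<in> Poly_Mapping.keys f. mon_deg m = d}"
  have "Poly_Mapping.keys f \<noteq> {}" using assms by simp
  then have "d \<in> mon_deg ` Poly_Mapping.keys f" unfolding d_def by (intro Max_in) auto
  then have A: "A \<noteq> {}" "finite A" by (auto simp: A_def)
  have "leading_mon f (Max A)"
    unfolding leading_mon_def
  proof (intro conjI ballI impI)
    show "Max A \<in> Poly_Mapping.keys f" using Max_in[OF A(2,1)] by (simp add: A_def)
    fix n assume n: "n \<in> Poly_Mapping.keys f" "n \<noteq> Max A"
    have "mon_deg n \<le> d" using n(1) by (simp add: d_def)
    moreover have "mon_deg (Max A) = d" using Max_in[OF A(2,1)] by (simp add: A_def)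
    moreover have "n < Max A" if "mon_deg n = d"
    proof -
      have "n \<le> Max A" using n(1) that by (intro Max_ge A(2)) (simp add: A_def)
      then show ?thesis using n(2) by simp
    qed
    ultimately show "mon_less n (Max A)" by (auto simp: mon_less_def)
  qed
  then show ?thesis by (rule that)
qed

text \<open>For finite \<open>B\<close> this turns \<open>mon_less\<close> into a comparison of
  natural numbers, which can be minimized and used as an induction measure.\<close>

definition mon_rank :: "nat set \<Rightarrow> (nat \<Rightarrow>\<^sub>0 nat) \<Rightarrow> nat" where
  "mon_rank B m = card {n. Poly_Mapping.keys n \<subseteq> B \<and> mon_less n m}"

lemma mon_rank_less:
  assumes "finite B" "Poly_Mapping.keys m \<subseteq> B" "mon_less m n"
  shows "mon_rank B m < mon_rank B n"
  unfolding mon_rank_def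
proof (rule psubset_card_mono)
  show "finite {l. Poly_Mapping.keys l \<subseteq> B \<and> mon_less l n}"
    by (rule finite_subset[OF _ bounded_deg_monomials(1)[OF assms(1), of "mon_deg n"]])
      (auto dest: mon_less_deg)
  show "{l. Poly_Mapping.keys l \<subseteq> B \<and> mon_less l m} \<subset> {l. Poly_Mapping.keys l \<subseteq> B \<and> mon_less l n}"
    using assms mon_less_trans mon_less_irrefl by blast
qed

section \<open>Noetherianity\<close>

lemma nat_seq_mono_subseq:
  fixes s :: "nat \<Rightarrow> nat"
  obtains r :: "nat \<Rightarrow> nat" where "strict_mono r" "mono (\<lambda>i. s (r i))"
proof -
  obtain r where r: "strict_mono r" "monoseq (\<lambda>i. s (r i))"
    using seq_monosub[of s] by blast
  show ?thesis
  proof (cases "mono (\<lambda>i. s (r i))")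
    case False
    then have dec: "s (r j) \<le> s (r i)" if "i \<le> j" for i j
      using r(2) that unfolding monoseq_def mono_def by blast
    \<comment> \<open>A weakly decreasing sequence is constant from the index of a least value on,
      so its tail is also weakly increasing.\<close>
    define N where "N = (ARG_MIN (\<lambda>i. s (r i)) i. True)"
    have "s (r N) \<le> s (r i)" for i
      unfolding N_def by (rule arg_min_nat_le) simp
    then have "s (r (N + i)) = s (r N)" for i
      using dec[of N "N + i"] by (intro antisym) auto
    then have "mono (\<lambda>i. s (r (N + i)))" by (simp add: mono_def)
    moreover have "strict_mono (\<lambda>i. r (N + i))" using r(1) by (simp add: strict_mono_def)
    ultimately show ?thesis by (intro that[of "\<lambda>i. r (N + i)"])
  qed (use r that in blast)
qed

text \<open>Passing to subsequences, one variable of \<open>B\<close> at a time, makes all exponents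
  weakly increasing. The first monomial of the final subsequence then divides the second.\<close>

lemma dickson:
  fixes f :: "nat \<Rightarrow> (nat \<Rightarrow>\<^sub>0 nat)"
  assumes "finite B" "\<And>i. Poly_Mapping.keys (f i) \<subseteq> B"
  obtains i j l where "i < j" "f j = f i + l"
proof -
  have "\<exists>r :: nat \<Rightarrow> nat. strict_mono r \<and> (\<forall>p\<in>B. mono (\<lambda>i. Poly_Mapping.lookup (f (r i)) p))"
    using assms(1)
  proof (induction B)
    case empty
    show ?case by (intro exI[of _ id]) (simp add: strict_mono_def)
  next
    case (insert q B)
    then obtain r :: "nat \<Rightarrow> nat"
      where r: "strict_mono r" "\<forall>p\<in>B. mono (\<lambda>i. Poly_Mapping.lookup (f (r i)) p)"
      by blast
    obtain r' :: "nat \<Rightarrow> nat" where r': "strict_mono r'" "mono (\<lambda>i. Poly_Mapping.lookup (f (r (r' i))) q)"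
      using nat_seq_mono_subseq[of "\<lambda>i. Poly_Mapping.lookup (f (r i)) q"] by blast
    have le: "r' i \<le> r' j" if "i \<le> j" for i j
      using r'(1) that by (simp add: strict_mono_less_eq)
    have "strict_mono (\<lambda>i. r (r' i))" using r(1) r'(1) by (simp add: strict_mono_def)
    then show ?case
      using r(2) r'(2) le by (intro exI[of _ "\<lambda>i. r (r' i)"]) (auto simp: mono_def)
  qed
  then obtain r :: "nat \<Rightarrow> nat"
    where r: "strict_mono r" "\<forall>p\<in>B. mono (\<lambda>i. Poly_Mapping.lookup (f (r i)) p)"
    by blast
  have "f (r 1) = f (r 0) + (f (r 1) - f (r 0))"
  proof (rule poly_mapping_eqI)
    fix p
    have "Poly_Mapping.lookup (f (r 0)) p \<le> Poly_Mapping.lookup (f (r 1)) p"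
    proof (cases "p \<in> B")
      case True
      then show ?thesis using r(2) by (auto simp: mono_def)
    next
      case False
      then have "p \<notin> Poly_Mapping.keys (f (r 0))" using assms(2) by blast
      then show ?thesis by (simp add: in_keys_iff)
    qed
    then show "Poly_Mapping.lookup (f (r 1)) p =
        Poly_Mapping.lookup (f (r 0) + (f (r 1) - f (r 0))) p"
      by (simp add: lookup_add lookup_minus)
  qed
  moreover have "r 0 < r 1" using r(1) by (simp add: strict_mono_def)
  ultimately show ?thesis using that by blast
qed

section \<open>Leading terms of multiples, and chains of ideals in finitely many variables\<close>

lemma keys_single_mult:
  fixes f :: "'k::field witt_poly"
  assumes "m \<in> Poly_Mapping.keys (Poly_Mapping.single l c * f)"
  shows "\<exists>n\<in>Poly_Mapping.keys f. m = n + l"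
proof -
  obtain a b where "m = a + b" "a \<in> Poly_Mapping.keys (Poly_Mapping.single l c)" "b \<in> Poly_Mapping.keys f"
    using assms keys_mult by blast
  then show ?thesis by (auto simp: add.commute split: if_splits)
qed

lemma lookup_single_mult:
  fixes f :: "'k::field witt_poly"
  shows "Poly_Mapping.lookup (Poly_Mapping.single l c * f) (m + l) = c * Poly_Mapping.lookup f m"
proof -
  have "Poly_Mapping.single l c * f =
      (\<Sum>n\<in>Poly_Mapping.keys f. Poly_Mapping.single (n + l) (c * Poly_Mapping.lookup f n))"
    by (subst witt_poly_sum_monomials[of f]) (simp add: sum_distrib_left mult_single add.commute)
  then show ?thesis
    by (auto simp: lookup_sum lookup_single when_def in_keys_iff sum.delta)
qed

lemma lookup_const_mult:
  "Poly_Mapping.lookup (witt_const c * f) m = c * Poly_Mapping.lookup f m"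
  using lookup_single_mult[of 0 c f m] by (simp add: witt_const_def)

text \<open>A new element of least leading monomial at each step would, by Dickson's lemma, allow a
  reduction of a later one by an earlier one.\<close>

lemma ideal_chain_stabilizes:
  fixes J :: "nat \<Rightarrow> 'k::field witt_poly set"
  assumes B: "finite B" and J: "\<And>i. ideal (J i) witt_sym" and inc: "\<And>i. J i \<subseteq> J (Suc i)"
    and new: "\<And>i. \<exists>f. witt_vars f \<subseteq> B \<and> f \<in> J (Suc i) \<and> f \<notin> J i"
  shows False
proof -
  define C where "C i = {(f, m). witt_vars f \<subseteq> B \<and> f \<in> J (Suc i) \<and> f \<notin> J i \<and> leading_mon f m}" for i
  define F where "F i = (ARG_MIN (\<lambda>(f, m). mon_rank B m) x. x \<in> C i)" for i
  define f where "f i = fst (F i)" for i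
  define m where "m i = snd (F i)" for i
  have ne: "\<exists>x. x \<in> C i" for i
  proof -
    from new obtain f where f: "witt_vars f \<subseteq> B" "f \<in> J (Suc i)" "f \<notin> J i" by blast
    then have "f \<noteq> 0" using ideal_witt_sym_0[OF J[of i]] by blast
    then obtain m where "leading_mon f m" by (rule leading_mon_exists)
    with f show ?thesis by (auto simp: C_def)
  qed
  have FC: "(f i, m i) \<in> C i" for i
  proof -
    obtain x where "x \<in> C i" using ne by blast
    then have "F i \<in> C i" unfolding F_def by (rule arg_min_natI)
    then show ?thesis by (simp add: f_def m_def)
  qed
  then have fm: "witt_vars (f i) \<subseteq> B" "f i \<in> J (Suc i)" "f i \<notin> J i" "leading_mon (f i) (m i)" for i
    by (simp_all add: C_def)
  have min: "mon_rank B (m i) \<le> mon_rank B n" if "(h, n) \<in> C i" for i h n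
    using arg_min_nat_le[of "\<lambda>x. x \<in> C i" "(h, n)" "\<lambda>(f, m). mon_rank B m"] that
    by (simp add: F_def m_def case_prod_beta)
  have "Poly_Mapping.keys (m i) \<subseteq> B" for i
    using fm(1,4)[of i] by (auto simp: leading_mon_def witt_vars_def)
  then obtain i j l where ij: "i < j" "m j = m i + l"
    using dickson[OF B] by blast
  define a b where "a = Poly_Mapping.lookup (f j) (m j)" and "b = Poly_Mapping.lookup (f i) (m i)"
  \<comment> \<open>The multiple of \<open>f i\<close> whose leading term is that of
    \<open>f j\<close>. It lies in \<open>J j\<close>, so \<open>f j - s\<close> is again new at
    stage \<open>j\<close>, but with smaller leading monomial.\<close>
  define s where "s = Poly_Mapping.single l (a / b) * f i"
  have b0: "b \<noteq> 0" using fm(4)[of i] by (simp add: b_def leading_mon_def in_keys_iff)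
  have "J i' \<subseteq> J j'" if "i' \<le> j'" for i' j'
    using lift_Suc_mono_le[of J, OF inc that] .
  then have fij: "f i \<in> J j" using fm(2)[of i] ij(1) by (meson Suc_leI subsetD)
  then have s: "s \<in> J j" unfolding s_def by (rule ideal_witt_sym_mult[OF J])
  define h where "h = f j - s"
  have hJ: "h \<in> J (Suc j)" using s inc fm(2)[of j] unfolding h_def by (blast intro: ideal_witt_sym_diff[OF J])
  have hnJ: "h \<notin> J j"
    using ideal_witt_sym_add[OF J[of j] _ s, of h] fm(3)[of j] by (auto simp: h_def)
  then have "h \<noteq> 0" using ideal_witt_sym_0[OF J[of j]] by blast
  then obtain n where n: "leading_mon h n" by (rule leading_mon_exists)
  have keys: "k \<in> Poly_Mapping.keys (f j) \<or> (\<exists>k'\<in>Poly_Mapping.keys (f i). k = k' + l)"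
    if "k \<in> Poly_Mapping.keys h" for k
  proof -
    have "k \<in> Poly_Mapping.keys (f j) \<or> k \<in> Poly_Mapping.keys s"
      using that keys_diff[of "f j" s] by (auto simp: h_def)
    then show ?thesis using keys_single_mult[of k l "a / b" "f i"] by (auto simp: s_def)
  qed
  have lB: "Poly_Mapping.keys l \<subseteq> B"
    using \<open>Poly_Mapping.keys (m j) \<subseteq> B\<close> ij(2) by (simp add: keys_add_nat)
  have "witt_vars h \<subseteq> B"
  proof -
    have fB: "Poly_Mapping.keys k \<subseteq> B" if "k \<in> Poly_Mapping.keys (f i')" for k i'
      using that fm(1)[of i'] by (auto simp: witt_vars_def)
    have "Poly_Mapping.keys k \<subseteq> B" if "k \<in> Poly_Mapping.keys h" for k
      using keys[OF that]
    proof
      assume "\<exists>k'\<in>Poly_Mapping.keys (f i). k = k' + l"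
      then obtain k' where "k' \<in> Poly_Mapping.keys (f i)" "k = k' + l" by blast
      then show ?thesis using fB[of k' i] lB by (simp only: keys_add_nat Un_subset_iff)
    qed (rule fB)
    then show ?thesis by (auto simp: witt_vars_def)
  qed
  then have "(h, n) \<in> C j" using hJ hnJ n by (simp add: C_def)
  then have "mon_rank B (m j) \<le> mon_rank B n" by (rule min)
  moreover have "mon_less n (m j)"
  proof -
    have nh: "n \<in> Poly_Mapping.keys h" using n by (simp add: leading_mon_def)
    have "Poly_Mapping.lookup h (m j) = 0"
      using b0 by (simp add: h_def s_def lookup_minus ij(2) lookup_single_mult a_def b_def)
    then have nm: "n \<noteq> m j" using nh by (auto simp: in_keys_iff)
    from keys[OF nh] show ?thesis
    proof
      assume "n \<in> Poly_Mapping.keys (f j)"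
      then show ?thesis using nm fm(4)[of j] by (auto simp: leading_mon_def)
    next
      assume "\<exists>k'\<in>Poly_Mapping.keys (f i). n = k' + l"
      then obtain k' where k': "k' \<in> Poly_Mapping.keys (f i)" "n = k' + l" by blast
      then have "mon_less k' (m i)" using nm fm(4)[of i] ij(2) by (auto simp: leading_mon_def)
      then show ?thesis using mon_less_add k'(2) ij(2) by simp
    qed
  qed
  moreover have "Poly_Mapping.keys n \<subseteq> B"
    using \<open>witt_vars h \<subseteq> B\<close> n by (auto simp: leading_mon_def witt_vars_def)
  ultimately show False using mon_rank_less[OF B, of n "m j"] by simp
qed

section \<open>Finiteness of the minimal primes avoiding \<open>g\<close>\<close>

lemma ideal_Inter_primes:
  assumes "\<And>P. P \<in> Q \<Longrightarrow> primeideal P witt_sym"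
  shows "ideal (\<Inter>Q :: 'k::field witt_poly set) witt_sym"
  using assms by (auto simp: ideal_witt_sym_iff primeideal_witt_sym_iff)

text \<open>An intersection of infinitely many such primes that is maximal among intersections of
  infinite subfamilies is prime, hence equal to each of the minimal primes of the subfamily.\<close>

lemma finite_minimal_primes_avoiding:
  fixes K :: "'k::field witt_poly set"
  assumes B: "finite B"
    and elim: "\<And>h. \<exists>a p. witt_vars p \<subseteq> B \<and> g ^ a * h - p \<in> K"
  shows "finite {P. minimal_prime_over witt_sym K P \<and> g \<notin> P}" (is "finite ?P")
proof (rule ccontr)
  assume inf: "infinite ?P"
  have prime: "primeideal P witt_sym" and KP: "K \<subseteq> P" and gP: "g \<notin> P" if "P \<in> ?P" for P
    using that by (auto simp: minimal_prime_over_def)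
  have min: "Q = P" if "P \<in> ?P" "primeideal Q witt_sym" "K \<subseteq> Q" "Q \<subseteq> P" for P Q
    using that by (auto simp: minimal_prime_over_def)
  have step: "\<exists>Q'. Q' \<subseteq> Q \<and> infinite Q' \<and> \<Inter>Q \<noteq> \<Inter>Q'" if Q: "Q \<subseteq> ?P" "infinite Q" for Q
  proof (rule ccontr)
    assume "\<not> ?thesis"
    then have eq: "\<Inter>Q' = \<Inter>Q" if "Q' \<subseteq> Q" "infinite Q'" for Q' using that by metis
    have "primeideal (\<Inter>Q) witt_sym"
      unfolding primeideal_witt_sym_iff
    proof (intro conjI allI impI)
      show "ideal (\<Inter>Q) witt_sym"
        by (rule ideal_Inter_primes, rule prime, erule subsetD[OF Q(1)])
      obtain P where P: "P \<in> Q" using infinite_imp_nonempty[OF Q(2)] by blast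
      then have "1 \<notin> P"
        using prime[OF subsetD[OF Q(1) P]] by (simp add: primeideal_witt_sym_iff)
      then show "1 \<notin> \<Inter>Q" using P by blast
      fix a b assume ab: "a * b \<in> \<Inter>Q"
      have "a \<in> P \<or> b \<in> P" if P: "P \<in> Q" for P
      proof -
        have "primeideal P witt_sym" by (rule prime[OF subsetD[OF Q(1) P]])
        then show ?thesis using ab P by (auto simp: primeideal_witt_sym_iff)
      qed
      then have "Q \<subseteq> {P \<in> Q. a \<in> P} \<union> {P \<in> Q. b \<in> P}" by auto
      then have "infinite {P \<in> Q. a \<in> P} \<or> infinite {P \<in> Q. b \<in> P}"
        using Q(2) finite_subset by blast
      then show "a \<in> \<Inter>Q \<or> b \<in> \<Inter>Q"
      proof
        assume "infinite {P \<in> Q. a \<in> P}"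
        then have "\<Inter>{P \<in> Q. a \<in> P} = \<Inter>Q" by (intro eq) auto
        then show ?thesis by blast
      next
        assume "infinite {P \<in> Q. b \<in> P}"
        then have "\<Inter>{P \<in> Q. b \<in> P} = \<Inter>Q" by (intro eq) auto
        then show ?thesis by blast
      qed
    qed
    moreover have "K \<subseteq> \<Inter>Q"
      by (rule Inter_greatest, rule KP, erule subsetD[OF Q(1)])
    ultimately have "\<Inter>Q = P" if "P \<in> Q" for P
      by (rule min[OF subsetD[OF Q(1) that] _ _ Inter_lower[OF that]])
    then have "Q \<subseteq> {\<Inter>Q}" by (intro subsetI) simp
    then show False using Q(2) finite_subset[of Q "{\<Inter>Q}"] by simp
  qed
  define big where "big Q \<longleftrightarrow> Q \<subseteq> ?P \<and> infinite Q" for Q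
  define below where "below Q Q' \<longleftrightarrow> Q' \<subseteq> Q \<and> \<Inter>Q \<noteq> \<Inter>Q'" for Q Q' :: "'k witt_poly set set"
  have ex: "\<exists>Q'. big Q' \<and> below Q Q'" if "big Q" for Q
  proof -
    have Q: "Q \<subseteq> ?P" "infinite Q" using that unfolding big_def by - (elim conjE, assumption)+
    from step[OF this] obtain Q' where Q': "Q' \<subseteq> Q" "infinite Q'" "\<Inter>Q \<noteq> \<Inter>Q'"
      by (elim exE conjE)
    have "Q' \<subseteq> ?P" by (rule order.trans[OF Q'(1) Q(1)])
    then have "big Q' \<and> below Q Q'" unfolding big_def below_def by (intro conjI Q')
    then show ?thesis ..
  qed
  have "big ?P" unfolding big_def by (intro conjI order.refl inf)
  \<comment> \<open>Dependent choice gives a decreasing sequence of families whose intersections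
    increase strictly.\<close>
  then have "\<exists>S. \<forall>n. big (S n) \<and> below (S n) (S (Suc n))"
    by (intro dependent_nat_choice[of "\<lambda>_. big" "\<lambda>_. below"] ex exI[of _ ?P])
  then obtain S where *: "\<forall>n. big (S n) \<and> below (S n) (S (Suc n))" ..
  have S: "S n \<subseteq> ?P" "S (Suc n) \<subseteq> S n" "\<Inter>(S n) \<noteq> \<Inter>(S (Suc n))" for n
    using *[rule_format, of n] unfolding big_def below_def by - (elim conjE, assumption)+
  have id: "ideal (\<Inter>(S n)) witt_sym" for n
    by (rule ideal_Inter_primes, rule prime, erule subsetD[OF S(1)])
  have sub: "\<Inter>(S n) \<subseteq> \<Inter>(S (Suc n))" for n
    by (rule Inter_anti_mono[OF S(2)])
  have new: "\<exists>f. witt_vars f \<subseteq> B \<and> f \<in> \<Inter>(S (Suc n)) \<and> f \<notin> \<Inter>(S n)" for n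
  proof -
    from S(3)[of n] sub[of n] have "\<Inter>(S n) \<subset> \<Inter>(S (Suc n))" by (simp add: psubset_eq)
    then obtain h where h: "h \<in> \<Inter>(S (Suc n))" "h \<notin> \<Inter>(S n)" by (meson psubset_imp_ex_mem DiffE)
    \<comment> \<open>Modulo a prime of the family, \<open>p\<close> equals \<open>h\<close> times a
      power of \<open>g\<close>, and \<open>g\<close> is outside that prime. Hence \<open>p\<close>
      and \<open>h\<close> lie in the same primes of the family, and the strict inclusion is already
      visible in the variables of \<open>B\<close>.\<close>
    obtain a p where p: "witt_vars p \<subseteq> B" "g ^ a * h - p \<in> K" using elim by blast
    have iff: "p \<in> P \<longleftrightarrow> h \<in> P" if "P \<in> ?P" for P
    proof -
      have P: "ideal P witt_sym" using prime[OF that] by (simp add: primeideal_witt_sym_iff)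
      have d: "g ^ a * h - p \<in> P" by (rule subsetD[OF KP[OF that] p(2)])
      have "p \<in> P \<longleftrightarrow> g ^ a * h \<in> P"
        using ideal_witt_sym_add[OF P d, of p] ideal_witt_sym_diff[OF P _ d, of "g ^ a * h"]
        by (auto simp only: diff_add_cancel diff_diff_eq2 add_diff_cancel_left')
      also have "\<dots> \<longleftrightarrow> h \<in> P"
      proof
        assume "g ^ a * h \<in> P"
        then have "g ^ a \<in> P \<or> h \<in> P"
          using prime[OF that] by (simp add: primeideal_witt_sym_iff)
        then show "h \<in> P" using prime_power_mem[OF prime[OF that]] gP[OF that] by blast
      qed (rule ideal_witt_sym_mult[OF P])
      finally show ?thesis .
    qed
    have "p \<in> P \<longleftrightarrow> h \<in> P" if "P \<in> S k" for P k
      by (rule iff, rule subsetD[OF S(1) that])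
    then have "p \<in> \<Inter>(S (Suc n))" "p \<notin> \<Inter>(S n)" using h by (simp_all add: Inter_iff)
    then show "\<exists>f. witt_vars f \<subseteq> B \<and> f \<in> \<Inter>(S (Suc n)) \<and> f \<notin> \<Inter>(S n)"
      using p(1) by (intro exI[of _ p] conjI)
  qed
  show False
    by (rule ideal_chain_stabilizes[of B "\<lambda>n. \<Inter>(S n)", OF B id sub new])
qed

section \<open>Elimination of the high variables\<close>

lemma witt_vars_pderiv: "witt_vars (witt_pderiv p f) \<subseteq> witt_vars f"
proof -
  obtain d where "f \<in> poly_space d (witt_vars f)" by (rule poly_space_exists)
  then have "witt_pderiv p f \<in> poly_space (d - 1) (witt_vars f)" by (rule poly_space_pderiv)
  then show ?thesis using poly_space_iff_vars by blast
qed

lemma poly_space_witt_vars: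
  assumes "witt_vars f \<subseteq> B"
  obtains d where "f \<in> poly_space d B"
proof -
  obtain d where "f \<in> poly_space d (witt_vars f)" by (rule poly_space_exists)
  then show ?thesis using that poly_space_mono[OF order.refl assms, of d] by blast
qed

text \<open>In one-based indices \<open>T = t + 1\<close>; the bracket \<open>{f, x\<^bsub>q+1\<^esub>}\<close> with \<open>q > t\<close> expresses
  \<open>g x\<^bsub>T+q+1\<^esub>\<close> through lower variables.\<close>

lemma elimination:
  fixes K :: "'k::field_char_0 witt_poly set"
  assumes K: "witt_poisson_ideal K" and f: "f \<in> K"
    and t: "t \<in> witt_vars f" "\<And>p. p \<in> witt_vars f \<Longrightarrow> p \<le> t"
  defines "g \<equiv> witt_pderiv t f" and "B \<equiv> {..<2 * t + 2}"
  shows "\<exists>a d. \<exists>p\<in>poly_space d B. g ^ a * h - p \<in> K"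
proof -
  have I: "ideal K witt_sym" using K by (simp add: witt_poisson_ideal_def)
  \<comment> \<open>The elements that \<open>g\<close> reduces to the variables of \<open>B\<close>.
    This set contains the constants and is closed under sums and products, so only the generators
    remain to be treated.\<close>
  define T where "T = {h. \<exists>a d. \<exists>p\<in>poly_space d B. g ^ a * h - p \<in> K}"
  have fB: "witt_vars f \<subseteq> B" using t(2) by (force simp: B_def)
  have gB: "witt_vars g \<subseteq> B" unfolding g_def using witt_vars_pderiv fB by blast
  obtain dg where dg: "g \<in> poly_space dg B" using poly_space_witt_vars[OF gB] by blast
  have base: "p \<in> T" if "p \<in> poly_space d B" for p d
    unfolding T_def using that ideal_witt_sym_0[OF I]
    by (intro CollectI exI[of _ 0] exI[of _ d] bexI[of _ p]) auto
  have const: "witt_const c \<in> T" for c by (rule base[OF poly_space_const[of c 0]])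
  have base_vars: "p \<in> T" if "witt_vars p \<subseteq> B" for p
    using poly_space_witt_vars[OF that] base by blast
  have mult: "u * v \<in> T" if uv: "u \<in> T" "v \<in> T" for u v
  proof -
    obtain a d p where p: "p \<in> poly_space d B" "g ^ a * u - p \<in> K"
      using uv(1) by (auto simp: T_def)
    obtain b e q where q: "q \<in> poly_space e B" "g ^ b * v - q \<in> K"
      using uv(2) by (auto simp: T_def)
    have "g ^ (a + b) * (u * v) - p * q = (g ^ a * u) * (g ^ b * v - q) + q * (g ^ a * u - p)"
      by (simp add: power_add algebra_simps)
    also have "\<dots> \<in> K" using p(2) q(2) by (intro ideal_witt_sym_add ideal_witt_sym_mult I)
    finally show ?thesis unfolding T_def
      using poly_space_mult[OF p(1) q(1)]
      by (intro CollectI exI[of _ "a + b"] exI[of _ "d + e"] bexI[of _ "p * q"])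
  qed
  have add: "u + v \<in> T" if uv: "u \<in> T" "v \<in> T" for u v
  proof -
    obtain a d p where p: "p \<in> poly_space d B" "g ^ a * u - p \<in> K"
      using uv(1) by (auto simp: T_def)
    obtain b e q where q: "q \<in> poly_space e B" "g ^ b * v - q \<in> K"
      using uv(2) by (auto simp: T_def)
    have "g ^ b * p + g ^ a * q \<in> poly_space (b * dg + d + (a * dg + e)) B"
      using poly_space_mult[OF poly_space_power[OF dg, of b] p(1)]
        poly_space_mult[OF poly_space_power[OF dg, of a] q(1)]
      by (intro poly_space_add) (auto intro: subsetD[OF poly_space_mono, rotated 2])
    moreover have "g ^ (a + b) * (u + v) - (g ^ b * p + g ^ a * q) =
        g ^ b * (g ^ a * u - p) + g ^ a * (g ^ b * v - q)"
      by (simp add: power_add algebra_simps)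
    moreover have "\<dots> \<in> K" using p(2) q(2) by (intro ideal_witt_sym_add ideal_witt_sym_mult I)
    ultimately show ?thesis unfolding T_def
      by (intro CollectI exI[of _ "a + b"] exI[of _ "b * dg + d + (a * dg + e)"]
          bexI[of _ "g ^ b * p + g ^ a * q"]) auto
  qed
  have sum: "sum u A \<in> T" if "\<And>a. a \<in> A \<Longrightarrow> u a \<in> T" for u and A :: "nat set"
    using that
    by (induction A rule: infinite_finite_induct) (auto intro: add base[OF poly_space_0])
  have gen: "witt_gen (j + 1) \<in> T" for j
  proof (induction j rule: less_induct)
    case (less j)
    show ?case
    proof (cases "j \<in> B")
      case True
      then show ?thesis by (intro base[OF poly_space_gen])
    next
      case False
      \<comment> \<open>Chosen so that \<open>(t + 1) + (q + 1) = j + 1\<close>. The bound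
        \<open>2 * t + 2\<close> in \<open>B\<close> ensures \<open>q > t\<close>, so the
        coefficient \<open>c t\<close> of the top term is nonzero.\<close>
      define q where "q = j - t - 1"
      have q: "t < q" "j = t + q + 1" using False by (auto simp: B_def q_def)
      define c where "c p = (of_int (int q - int p) :: 'k)" for p :: nat
      have c0: "c t \<noteq> (0 :: 'k)" using q(1) by (simp add: c_def)
      define tm where "tm p = witt_const (c p) * witt_gen ((p + 1) + (q + 1)) * witt_pderiv p f"
        for p
      define rest where "rest = (\<Sum>p\<in>witt_vars f - {t}. tm p)"
      have vq: "witt_vars (witt_gen (q + 1) :: 'k witt_poly) = {q}"
        by (simp add: witt_vars_def witt_gen_def)
      have "witt_bracket f (witt_gen (q + 1)) = (\<Sum>p\<in>witt_vars f. tm p)"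
        unfolding witt_bracket_def vq by (simp add: tm_def c_def witt_pderiv_gen)
      also have "\<dots> = tm t + rest"
        unfolding rest_def by (rule sum.remove) (use t(1) finite_witt_vars in auto)
      finally have "tm t + rest \<in> K"
        using K f unfolding witt_poisson_ideal_def by metis
      then have "witt_const (1 / c t) * (tm t + rest) \<in> K" by (rule ideal_witt_sym_mult[OF I])
      moreover have "witt_const (1 / c t) * tm t = g * witt_gen (j + 1)"
      proof -
        have "witt_const (1 / c t) * witt_const (c t) = (1 :: 'k witt_poly)"
          using c0 by (simp add: witt_const_def mult_single)
        moreover have "witt_const (1 / c t) * tm t =
            (witt_const (1 / c t) * witt_const (c t)) * (g * witt_gen (j + 1))"
          unfolding tm_def g_def q(2) by (simp add: mult_ac add_ac)
        ultimately show ?thesis by simp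
      qed
      ultimately have K1: "g * witt_gen (j + 1) + witt_const (1 / c t) * rest \<in> K"
        by (simp add: distrib_left)
      \<comment> \<open>For \<open>p < t\<close> the generator in \<open>tm p\<close> has index
        below \<open>j + 1\<close>, so the induction hypothesis applies.\<close>
      have "tm p \<in> T" if p: "p \<in> witt_vars f - {t}" for p
      proof -
        have "p < t" using p t(2)[of p] by auto
        then have "witt_gen ((p + q + 1) + 1) \<in> T" by (intro less.IH) (simp add: q(2))
        then have "witt_gen ((p + 1) + (q + 1)) \<in> T" by (simp add: add_ac)
        moreover have "witt_pderiv p f \<in> T"
          using witt_vars_pderiv fB by (intro base_vars) blast
        ultimately show ?thesis unfolding tm_def by (intro mult const)
      qed
      then have "witt_const (1 / c t) * rest \<in> T"
        unfolding rest_def by (rule mult[OF const sum])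
      then obtain a d p where p: "p \<in> poly_space d B" "g ^ a * (witt_const (1 / c t) * rest) - p \<in> K"
        by (auto simp: T_def)
      have "g ^ Suc a * witt_gen (j + 1) - (witt_const (- 1) * p) =
        g ^ a * (g * witt_gen (j + 1) + witt_const (1 / c t) * rest) -
        (g ^ a * (witt_const (1 / c t) * rest) - p)"
      proof -
        have "witt_const (- 1) = (- 1 :: 'k witt_poly)"
          by (simp add: witt_const_def single_uminus)
        then show ?thesis by (simp add: algebra_simps)
      qed
      also have "\<dots> \<in> K" by (rule ideal_witt_sym_diff[OF I ideal_witt_sym_mult[OF I K1] p(2)])
      finally show ?thesis unfolding T_def
        using poly_space_smult[OF p(1)]
        by (intro CollectI exI[of _ "Suc a"] exI[of _ d] bexI[of _ "witt_const (- 1) * p"])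
    qed
  qed
  have "h \<in> T"
  proof (induction h rule: witt_poly_induct)
    case (gen n)
    then show ?case using \<open>\<And>j. witt_gen (j + 1) \<in> T\<close>[of "n - 1"] by simp
  qed (fact const add mult)+
  then show ?thesis by (simp add: T_def)
qed

section \<open>Polynomial relations among many variables\<close>

text \<open>Gaussian elimination, one monomial \<open>m\<close> at a time: if some
  \<open>q e0\<close> contains \<open>m\<close>, it serves as a pivot to remove \<open>m\<close>
  from the others, at the cost of one vector.\<close>

lemma linear_dependence:
  fixes q :: "'a \<Rightarrow> 'k::field witt_poly"
  assumes "finite F" "finite E" "card F < card E"
    and "\<And>e. e \<in> E \<Longrightarrow> Poly_Mapping.keys (q e) \<subseteq> F"
  shows "\<exists>c. (\<exists>e\<in>E. c e \<noteq> 0) \<and> (\<Sum>e\<in>E. witt_const (c e) * q e) = 0"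
  using assms
proof (induction F arbitrary: E q)
  case empty
  then have "q e = 0" if "e \<in> E" for e using that by simp
  moreover obtain e where "e \<in> E" using empty by fastforce
  ultimately show ?case by (intro exI[of _ "\<lambda>_. 1"]) auto
next
  case (insert m F)
  show ?case
  proof (cases "\<forall>e\<in>E. Poly_Mapping.lookup (q e) m = 0")
    case True
    then have "m \<notin> Poly_Mapping.keys (q e)" if "e \<in> E" for e
      using that by (simp add: in_keys_iff)
    then have "Poly_Mapping.keys (q e) \<subseteq> F" if "e \<in> E" for e
      using insert.prems(3)[OF that] that by blast
    then show ?thesis using insert by (intro insert.IH) auto
  next
    case False
    then obtain e0 where e0: "e0 \<in> E" "Poly_Mapping.lookup (q e0) m \<noteq> 0" by blast
    define r where "r e = Poly_Mapping.lookup (q e) m / Poly_Mapping.lookup (q e0) m" for e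
    define q' where "q' e = q e - witt_const (r e) * q e0" for e
    have keys: "Poly_Mapping.keys (q' e) \<subseteq> F" if "e \<in> E" for e
    proof
      fix k assume "k \<in> Poly_Mapping.keys (q' e)"
      then have k: "Poly_Mapping.lookup (q e) k - r e * Poly_Mapping.lookup (q e0) k \<noteq> 0"
        by (simp add: in_keys_iff q'_def lookup_minus lookup_const_mult)
      then have "k \<noteq> m" using e0(2) by (auto simp: r_def)
      moreover have "k \<in> Poly_Mapping.keys (q e) \<or> k \<in> Poly_Mapping.keys (q e0)"
        using k by (auto simp: in_keys_iff)
      ultimately show "k \<in> F" using insert.prems(3) that e0(1) by blast
    qed
    have "card F < card (E - {e0})" using insert e0(1) by simp
    then obtain c where c: "\<exists>e\<in>E - {e0}. c e \<noteq> 0" "(\<Sum>e\<in>E - {e0}. witt_const (c e) * q' e) = 0"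
      using insert.IH[of "E - {e0}" q'] keys insert.prems(1) by auto
    \<comment> \<open>The coefficient of the pivot collects the multiples of \<open>q e0\<close>
      subtracted in the vectors \<open>q' e\<close>.\<close>
    define c' where "c' e = (if e = e0 then - (\<Sum>e\<in>E - {e0}. c e * r e) else c e)" for e
    have wc: "witt_const (a * b) = witt_const a * (witt_const b :: 'k witt_poly)" for a b :: 'k
      by (simp add: witt_const_def mult_single)
    have ws: "witt_const (- sum u A) = - (\<Sum>a\<in>A. witt_const (u a) :: 'k witt_poly)"
      for u :: "'a \<Rightarrow> 'k" and A
      by (induction A rule: infinite_finite_induct)
        (simp_all add: witt_const_def single_uminus single_add single_diff)
    have "(\<Sum>e\<in>E. witt_const (c' e) * q e) =
        witt_const (c' e0) * q e0 + (\<Sum>e\<in>E - {e0}. witt_const (c e) * q e)"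
      by (subst sum.remove[OF insert.prems(1) e0(1)]) (simp add: c'_def)
    also have "\<dots> = (\<Sum>e\<in>E - {e0}. witt_const (c e) * q' e)"
      by (simp add: c'_def ws wc q'_def algebra_simps sum_distrib_left sum_subtractf)
    finally have "(\<Sum>e\<in>E. witt_const (c' e) * q e) = 0" using c(2) by simp
    moreover have "\<exists>e\<in>E. c' e \<noteq> 0" using c(1) by (auto simp: c'_def)
    ultimately show ?thesis by blast
  qed
qed

text \<open>The monomials of degree at most \<open>n\<close> in each of \<open>s + 1\<close> variables outnumber, for large \<open>n\<close>, the
  monomials of degree at most \<open>C n\<close> in \<open>s\<close> variables.\<close>

lemma elimination_relation:
  fixes K :: "'k::field witt_poly set"
  assumes I: "ideal K witt_sym" and B: "finite B" and g: "witt_vars g \<subseteq> B"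
    and elim: "\<And>h. \<exists>a d. \<exists>p\<in>poly_space d B. g ^ a * h - p \<in> K"
    and Y: "finite Y" "card B < card Y"
  obtains u a where "u \<noteq> 0" "witt_vars u \<subseteq> Y" "g ^ a * u \<in> K"
proof -
  obtain Y' where Y': "Y' \<subseteq> Y" "card Y' = card B + 1" "finite Y'"
    using obtain_subset_with_card_n[of "card B + 1" Y] Y by (metis Suc_eq_plus1 Suc_leI finite_subset)
  have "\<forall>y :: nat. \<exists>a d p. p \<in> poly_space d B \<and> g ^ a * witt_gen (y + 1) - p \<in> K"
    using elim by blast
  then obtain a0 d0 p0 where p0: "\<And>y. p0 y \<in> poly_space (d0 y) B"
      "\<And>y. g ^ a0 y * witt_gen (y + 1) - p0 y \<in> K"
    by metis
  obtain dg where dg: "g \<in> poly_space dg B" using poly_space_witt_vars[OF g] by blast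
  \<comment> \<open>A common power of \<open>g\<close> for all variables in \<open>Y'\<close>;
    \<open>c\<close> is a matching common degree bound, also for \<open>g ^ a\<close>
    itself.\<close>
  define a where "a = (\<Sum>y\<in>Y'. a0 y)"
  define c where "c = a * dg + (\<Sum>y\<in>Y'. d0 y)"
  have ga: "g ^ a \<in> poly_space c B"
    by (rule subsetD[OF poly_space_mono poly_space_power[OF dg]]) (auto simp: c_def)
  have gens: "\<exists>p\<in>poly_space c B. g ^ a * witt_gen (y + 1) - p \<in> K" if y: "y \<in> Y'" for y
  proof -
    have ay: "a0 y \<le> a" and dy: "d0 y \<le> (\<Sum>y\<in>Y'. d0 y)"
      using y Y'(3) by (auto simp: a_def intro: member_le_sum)
    define p where "p = g ^ (a - a0 y) * p0 y"
    have "g ^ (a - a0 y) * (g ^ a0 y * witt_gen (y + 1) - p0 y) \<in> K"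
      by (rule ideal_witt_sym_mult[OF I p0(2)])
    moreover have "g ^ (a - a0 y) * g ^ a0 y = g ^ a" using ay by (simp flip: power_add)
    then have "g ^ (a - a0 y) * (g ^ a0 y * witt_gen (y + 1) - p0 y) = g ^ a * witt_gen (y + 1) - p"
      by (simp add: p_def right_diff_distrib flip: mult.assoc)
    moreover have "(a - a0 y) * dg + d0 y \<le> c" using dy by (auto simp: c_def intro!: add_mono)
    then have "p \<in> poly_space c B"
      unfolding p_def
      by (rule subsetD[OF poly_space_mono poly_space_mult[OF poly_space_power[OF dg] p0(1)]]) simp
    ultimately show ?thesis by (intro bexI[of _ p]) auto
  qed
  \<comment> \<open>All monomials of degree at most \<open>M\<close> receive the same power of
    \<open>g\<close>, so that a linear relation among their reductions lifts to a relation among the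
    monomials.\<close>
  have mons: "\<exists>q\<in>poly_space (c * M) B. g ^ (a * M) * Poly_Mapping.single e 1 - q \<in> K"
    if "Poly_Mapping.keys e \<subseteq> Y'" "mon_deg e \<le> M" for e M
    using that
  proof (induction M arbitrary: e)
    case 0
    then have "e = 0" by (simp add: mon_deg_eq_0_iff)
    then show ?case
      using poly_space_1 ideal_witt_sym_0[OF I] by (intro bexI[of _ 1]) auto
  next
    case (Suc M)
    show ?case
    proof (cases "e = 0")
      case True
      then have "mon_deg e \<le> M" by simp
      with Suc obtain q where q: "q \<in> poly_space (c * M) B"
          "g ^ (a * M) * Poly_Mapping.single e 1 - q \<in> K" by blast
      have "g ^ a * (g ^ (a * M) * Poly_Mapping.single e 1 - q) \<in> K"
        by (rule ideal_witt_sym_mult[OF I q(2)])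
      then show ?thesis using poly_space_mult[OF ga q(1)]
        by (intro bexI[of _ "g ^ a * q"]) (simp_all add: power_add algebra_simps)
    next
      case False
      then obtain y where y: "y \<in> Poly_Mapping.keys e" by (metis all_not_in_conv keys_eq_empty)
      define e' where "e' = e - Poly_Mapping.single y 1"
      have e: "e = e' + Poly_Mapping.single y 1"
        unfolding e'_def by (rule diff_single_add_single[OF y, symmetric])
      have "Poly_Mapping.keys e' \<subseteq> Y'" "mon_deg e' \<le> M"
        using Suc.prems by (auto simp: e keys_add_nat mon_deg_add)
      then obtain q where q: "q \<in> poly_space (c * M) B"
          "g ^ (a * M) * Poly_Mapping.single e' 1 - q \<in> K" using Suc.IH by blast
      obtain p where p: "p \<in> poly_space c B" "g ^ a * witt_gen (y + 1) - p \<in> K"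
        using gens[of y] y Suc.prems(1) by blast
      have "Poly_Mapping.single e (1 :: 'k) = Poly_Mapping.single e' 1 * witt_gen (y + 1)"
        by (simp add: witt_gen_def mult_single e)
      then have "g ^ (a * Suc M) * Poly_Mapping.single e 1 - p * q =
          (g ^ a * witt_gen (y + 1)) * (g ^ (a * M) * Poly_Mapping.single e' 1 - q) +
          q * (g ^ a * witt_gen (y + 1) - p)"
        by (simp add: power_add algebra_simps)
      also have "\<dots> \<in> K" by (intro ideal_witt_sym_add ideal_witt_sym_mult I q p)
      finally show ?thesis using poly_space_mult[OF p(1) q(1)]
        by (intro bexI[of _ "p * q"]) simp_all
    qed
  qed
  \<comment> \<open>These choices give \<open>c * M + 1 \<le> W * (n + 1)\<close>. Since
    \<open>W ^ card B = n\<close>, at most \<open>n * (n + 1) ^ card B\<close> monomials are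
    available for the reductions, fewer than the \<open>(n + 1) ^ (card B + 1)\<close> elements of
    \<open>E\<close>.\<close>
  define W where "W = c * (card B + 1) + 1"
  define n where "n = W ^ card B"
  define M where "M = (card B + 1) * n"
  define E where "E = {e. Poly_Mapping.keys e \<subseteq> Y' \<and> (\<forall>y\<in>Y'. Poly_Mapping.lookup e y \<le> n)}"
  define F where "F = {m. Poly_Mapping.keys m \<subseteq> B \<and> mon_deg m \<le> c * M}"
  have finE: "finite E" and cardE: "card E = (n + 1) ^ (card B + 1)"
    using finite_bounded_monomials[OF Y'(3), of "\<lambda>_. n"] Y'(2) by (simp_all add: E_def)
  have "finite F" and "card F \<le> (c * M + 1) ^ card B"
    using bounded_deg_monomials[OF B] by (simp_all add: F_def)
  moreover have "(c * M + 1) ^ card B \<le> (W * (n + 1)) ^ card B"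
    by (rule power_mono) (auto simp: W_def M_def algebra_simps)
  moreover have "(W * (n + 1)) ^ card B = n * (n + 1) ^ card B"
    by (simp only: power_mult_distrib n_def)
  moreover have "n * (n + 1) ^ card B < card E" by (simp add: cardE)
  ultimately have F: "finite F" "card F < card E" by linarith+
  have Edeg: "mon_deg e \<le> M" if "e \<in> E" for e
  proof -
    have "mon_deg e = (\<Sum>y\<in>Y'. Poly_Mapping.lookup e y)"
      using that Y'(3) by (intro mon_deg_superset) (auto simp: E_def)
    also have "\<dots> \<le> card Y' * n"
      using that by (intro sum_bounded_above[where K = n, simplified]) (auto simp: E_def)
    finally show ?thesis by (simp add: M_def Y'(2))
  qed
  have "\<forall>e\<in>E. \<exists>q. q \<in> poly_space (c * M) B \<and> g ^ (a * M) * Poly_Mapping.single e 1 - q \<in> K"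
  proof
    fix e assume e: "e \<in> E"
    then have "Poly_Mapping.keys e \<subseteq> Y'" by (simp add: E_def)
    from mons[OF this Edeg[OF e]]
    show "\<exists>q. q \<in> poly_space (c * M) B \<and> g ^ (a * M) * Poly_Mapping.single e 1 - q \<in> K" by blast
  qed
  then obtain q where q: "\<And>e. e \<in> E \<Longrightarrow> q e \<in> poly_space (c * M) B"
      "\<And>e. e \<in> E \<Longrightarrow> g ^ (a * M) * Poly_Mapping.single e 1 - q e \<in> K"
    by metis
  have "Poly_Mapping.keys (q e) \<subseteq> F" if "e \<in> E" for e
    using q(1)[OF that] by (auto simp: F_def poly_space_def)
  then obtain k where k: "\<exists>e\<in>E. k e \<noteq> 0" "(\<Sum>e\<in>E. witt_const (k e) * q e) = 0"
    using linear_dependence[OF F(1) finE F(2), of q] by blast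
  \<comment> \<open>The relation among the reductions is transferred to the monomials themselves.
    Distinct monomials do not merge, so \<open>u\<close> is nonzero.\<close>
  define u where "u = (\<Sum>e\<in>E. Poly_Mapping.single e (k e))"
  have lk: "Poly_Mapping.lookup u e = (if e \<in> E then k e else 0)" for e
    using finE by (simp add: u_def lookup_sum lookup_single when_def sum.delta)
  show ?thesis
  proof (rule that)
    show "u \<noteq> 0" using k(1) lk by (metis lookup_zero)
    have "Poly_Mapping.keys u \<subseteq> E" using lk by (auto simp: in_keys_iff split: if_splits)
    then show "witt_vars u \<subseteq> Y" using Y'(1) by (force simp: witt_vars_def E_def)
    have "g ^ (a * M) * u = (\<Sum>e\<in>E. witt_const (k e) * (g ^ (a * M) * Poly_Mapping.single e 1))"
      by (simp add: u_def sum_distrib_left mult.left_commute[of "witt_const _"])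
        (simp add: witt_const_def mult_single)
    also have "\<dots> = (\<Sum>e\<in>E. witt_const (k e) * (g ^ (a * M) * Poly_Mapping.single e 1 - q e))"
      using k(2) by (simp add: right_diff_distrib sum_subtractf)
    also have "\<dots> \<in> K" by (intro ideal_witt_sym_sum ideal_witt_sym_mult I q(2))
    finally show "g ^ (a * M) * u \<in> K" .
  qed
qed

section \<open>Induction on the degree of an element of the ideal\<close>

text \<open>A form of transcendence degree at most \<open>D\<close> for the quotient by
  \<open>K\<close>, tested on sets of variables only: no more than \<open>D\<close> of them are
  algebraically independent modulo \<open>K\<close>.\<close>

definition bounded_transcendence :: "nat \<Rightarrow> 'k::field witt_poly set \<Rightarrow> bool" where
  "bounded_transcendence D K \<longleftrightarrow>
    (\<forall>Y. finite Y \<and> D < card Y \<longrightarrow> (\<exists>h\<in>K. h \<noteq> 0 \<and> witt_vars h \<subseteq> Y))"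

lemma witt_vars_mult: "witt_vars (f * g) \<subseteq> witt_vars f \<union> witt_vars g"
  using keys_mult[of f g] by (fastforce simp: witt_vars_def keys_add_nat)

lemma witt_vars_1 [simp]: "witt_vars 1 = {}"
  by (simp add: witt_vars_def)

lemma witt_vars_power: "witt_vars (f ^ n) \<subseteq> witt_vars f"
  by (induction n) (use witt_vars_mult in auto)

lemma power_mult_mem_rad:
  assumes "ideal K witt_sym" "g ^ a * u \<in> K"
  shows "g * u \<in> rad K"
proof -
  \<comment> \<open>The exponent is \<open>Suc a\<close> rather than \<open>a\<close> in order to
    cover \<open>a = 0\<close>.\<close>
  have eq: "(g * u) ^ Suc a = (g * u ^ a) * (g ^ a * u)"
    unfolding power_mult_distrib power_Suc by (simp only: mult_ac)
  have "(g * u) ^ Suc a \<in> K" unfolding eq by (rule ideal_witt_sym_mult[OF assms])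
  then show ?thesis unfolding rad_def by blast
qed

text \<open>Nilpotency of \<open>g\<close> at \<open>P\<close> provides \<open>y \<notin> P\<close>
  with \<open>g * y \<in> rad K\<close>. Every \<open>w\<close> in the double colon ideal then
  satisfies \<open>w * y \<in> rad K \<subseteq> P\<close>, hence \<open>w \<in> P\<close>;
  minimality passes to the larger ideal.\<close>

lemma minimal_prime_over_bicolon:
  fixes K :: "'k::field witt_poly set"
  assumes K: "ideal K witt_sym" and P: "minimal_prime_over witt_sym K P" and g: "g \<in> P"
  shows "minimal_prime_over witt_sym (bicolon K g) P"
proof -
  obtain y a where y: "y \<notin> P" "g ^ a * y \<in> K"
    using minimal_prime_nilpotent[OF K P g] by blast
  have prime: "primeideal P witt_sym" and KP: "K \<subseteq> P"
    and min: "\<And>Q. primeideal Q witt_sym \<Longrightarrow> K \<subseteq> Q \<Longrightarrow> Q \<subseteq> P \<Longrightarrow> Q = P"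
    using P by (auto simp: minimal_prime_over_def)
  have gy: "g * y \<in> rad K" by (rule power_mult_mem_rad[OF K y(2)])
  have "w \<in> P" if "w \<in> bicolon K g" for w
  proof -
    have "w * y \<in> rad K" using that gy by (simp add: bicolon_def)
    then obtain n where "(w * y) ^ n \<in> P" using KP by (auto simp: rad_def)
    then have "w * y \<in> P" by (rule prime_power_mem[OF prime])
    then show ?thesis using prime y(1) by (auto simp: primeideal_witt_sym_iff)
  qed
  then show ?thesis
    unfolding minimal_prime_over_def
    using prime min subset_bicolon[OF K, of g] by (meson order.trans subsetI)
qed

text \<open>A relation \<open>u\<close> obtained by elimination satisfies
  \<open>g * u \<in> rad K\<close>, and a relation \<open>v\<close> comes from
  \<open>bicolon K g\<close>. Then \<open>v * u \<in> rad K\<close>, and some power of this nonzero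
  product is a relation modulo \<open>K\<close> in the same variables.\<close>

lemma bounded_transcendence_step:
  fixes K :: "'k::field_char_0 witt_poly set"
  assumes I: "ideal K witt_sym" and B: "finite B" and g: "witt_vars g \<subseteq> B"
    and elim: "\<And>h. \<exists>a d. \<exists>p\<in>poly_space d B. g ^ a * h - p \<in> K"
    and D: "bounded_transcendence D (bicolon K g)"
  shows "bounded_transcendence (max D (card B)) K"
  unfolding bounded_transcendence_def
proof (intro allI impI)
  fix Y :: "nat set" assume Y: "finite Y \<and> max D (card B) < card Y"
  then obtain u a where u: "u \<noteq> 0" "witt_vars u \<subseteq> Y" "g ^ a * u \<in> K"
    using elimination_relation[OF I B g elim, of Y] by auto
  from D Y obtain v where v: "v \<in> bicolon K g" "v \<noteq> 0" "witt_vars v \<subseteq> Y"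
    unfolding bounded_transcendence_def by (metis max_less_iff_conj)
  have "v * u \<in> rad K"
    using v(1) power_mult_mem_rad[OF I u(3)] by (simp add: bicolon_def)
  then obtain n where "(v * u) ^ n \<in> K" by (auto simp: rad_def)
  moreover have "(v * u) ^ n \<noteq> 0" using u(1) v(2) by simp
  moreover have "witt_vars ((v * u) ^ n) \<subseteq> Y"
    using witt_vars_power[of "v * u" n] witt_vars_mult[of v u] u(2) v(3) by blast
  ultimately show "\<exists>h\<in>K. h \<noteq> 0 \<and> witt_vars h \<subseteq> Y" by blast
qed

text \<open>Here \<open>K\<close> is the whole ring: no prime contains it, and \<open>1\<close>
  serves as a relation for every set of variables.\<close>

lemma poisson_ideal_const:
  fixes K :: "'k::field witt_poly set"
  assumes K: "ideal K witt_sym" "f \<in> K" "f \<noteq> 0" "witt_vars f = {}"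
  shows "finite {P. minimal_prime_over witt_sym K P} \<and> bounded_transcendence 0 K"
proof -
  obtain c where c: "f = witt_const c" by (rule poly_space_no_vars[OF K(4)])
  then have "c \<noteq> 0" using K(3) by (auto simp: witt_const_def)
  then have UN: "K = UNIV" using ideal_witt_sym_eq_UNIV[OF K(1)] K(2) c by blast
  have "\<not> minimal_prime_over witt_sym K P" for P
    by (auto simp: minimal_prime_over_def primeideal_witt_sym_iff UN)
  then have "{P. minimal_prime_over witt_sym K P} = {}" by simp
  moreover have "bounded_transcendence 0 K"
    unfolding bounded_transcendence_def UN by (intro allI impI bexI[of _ 1]) auto
  ultimately show ?thesis by simp
qed

text \<open>Both \<open>K\<close> and \<open>f\<close> vary in the induction: the derivative
  \<open>g\<close>, of smaller degree bound and nonzero, takes the place of \<open>f\<close>, and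
  \<open>bicolon K g\<close> that of \<open>K\<close>.\<close>

lemma poisson_ideal_finiteness:
  fixes K :: "'k::field_char_0 witt_poly set"
  assumes "witt_poisson_ideal K" "f \<in> K" "f \<noteq> 0" "f \<in> poly_space d UNIV"
  shows "finite {P. minimal_prime_over witt_sym K P} \<and> (\<exists>D. bounded_transcendence D K)"
  using assms
proof (induction d arbitrary: K f)
  case 0
  then have "witt_vars f = {}"
    by (auto simp: poly_space_def witt_vars_def mon_deg_eq_0_iff)
  then show ?case using 0 poisson_ideal_const[of K f] by (auto simp: witt_poisson_ideal_def)
next
  case (Suc d)
  have I: "ideal K witt_sym" using Suc.prems(1) by (simp add: witt_poisson_ideal_def)
  show ?case
  proof (cases "witt_vars f = {}")
    case True
    then show ?thesis using Suc.prems(2,3) poisson_ideal_const[OF I, of f] by auto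
  next
    case False
    define t where "t = Max (witt_vars f)"
    define g where "g = witt_pderiv t f"
    define B where "B = {..<2 * t + 2}"
    have t: "t \<in> witt_vars f" "\<And>p. p \<in> witt_vars f \<Longrightarrow> p \<le> t"
      using False by (auto simp: t_def finite_witt_vars)
    have "\<exists>a d. \<exists>p\<in>poly_space d B. g ^ a * h - p \<in> K" for h
      unfolding g_def B_def by (rule elimination[OF Suc.prems(1,2) t])
    note elim = this
    have B: "finite B" by (simp add: B_def)
    have gB: "witt_vars g \<subseteq> B"
      unfolding g_def using witt_vars_pderiv[of t f] t(2) by (force simp: B_def)
    have "g \<in> poly_space (Suc d - 1) UNIV" unfolding g_def by (rule poly_space_pderiv[OF Suc.prems(4)])
    moreover have "g \<noteq> 0" unfolding g_def by (rule witt_pderiv_neq_0[OF t(1)])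
    ultimately have IH: "finite {P. minimal_prime_over witt_sym (bicolon K g) P}"
      "\<exists>D. bounded_transcendence D (bicolon K g)"
      using Suc.IH[OF poisson_ideal_bicolon[OF Suc.prems(1)] mem_bicolon[of g K]] by auto
    have "{P. minimal_prime_over witt_sym K P} \<subseteq>
        {P. minimal_prime_over witt_sym K P \<and> g \<notin> P} \<union>
        {P. minimal_prime_over witt_sym (bicolon K g) P}"
      using minimal_prime_over_bicolon[OF I] by blast
    moreover have "finite {P. minimal_prime_over witt_sym K P \<and> g \<notin> P}"
    proof (rule finite_minimal_primes_avoiding[OF B])
      fix h
      obtain a d p where "p \<in> poly_space d B" "g ^ a * h - p \<in> K" using elim[of h] by blast
      then show "\<exists>a p. witt_vars p \<subseteq> B \<and> g ^ a * h - p \<in> K"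
        using poly_space_iff_vars[of p d B] by blast
    qed
    ultimately have "finite {P. minimal_prime_over witt_sym K P}"
      using IH(1) by (meson finite_UnI finite_subset)
    then show ?thesis using IH(2) bounded_transcendence_step[OF I B gB elim] by blast
  qed
qed

section \<open>Standard monomials\<close>

text \<open>Fixing the set \<open>Z\<close> of positions with exponent above \<open>b\<close> leaves
  \<open>d + 1\<close> choices at each of at most \<open>D\<close> positions and
  \<open>b + 1\<close> choices elsewhere. The power of \<open>d + 1\<close> is therefore independent
  of the number of variables.\<close>

lemma card_sparse_monomials:
  fixes S :: "(nat \<Rightarrow>\<^sub>0 nat) set"
  assumes B: "finite B"
    and S: "\<And>m. m \<in> S \<Longrightarrow> Poly_Mapping.keys m \<subseteq> B \<and> mon_deg m \<le> d \<and>
      card {p \<in> B. b < Poly_Mapping.lookup m p} \<le> D"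
  shows "finite S" "card S \<le> 2 ^ card B * (b + 1) ^ card B * (d + 1) ^ D"
proof -
  define M where "M Z = {m. Poly_Mapping.keys m \<subseteq> B \<and>
      (\<forall>p\<in>B. Poly_Mapping.lookup m p \<le> (if p \<in> Z then d else b))}" for Z
  define Zs where "Zs = {Z. Z \<subseteq> B \<and> card Z \<le> D}"
  have finZ: "finite Zs" and cZ: "card Zs \<le> 2 ^ card B"
    using B card_mono[of "Pow B" Zs] by (auto simp: Zs_def card_Pow)
  have sub: "S \<subseteq> (\<Union>Z\<in>Zs. M Z)"
  proof
    fix m assume "m \<in> S"
    note m = S[OF this]
    have "m \<in> M {p \<in> B. b < Poly_Mapping.lookup m p}"
      using m lookup_le_mon_deg[of m] by (auto simp: M_def intro: order.trans)
    moreover have "{p \<in> B. b < Poly_Mapping.lookup m p} \<in> Zs" using m by (auto simp: Zs_def)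
    ultimately show "m \<in> (\<Union>Z\<in>Zs. M Z)" by blast
  qed
  have finM: "finite (M Z)" for Z
    unfolding M_def by (rule finite_bounded_monomials(1)[OF B])
  have cM: "card (M Z) \<le> (b + 1) ^ card B * (d + 1) ^ D" if Z: "Z \<in> Zs" for Z
  proof -
    have "card (M Z) = (\<Prod>p\<in>B. if p \<in> Z then d + 1 else b + 1)"
      unfolding M_def finite_bounded_monomials(2)[OF B] by (intro prod.cong) auto
    also have "\<dots> = (d + 1) ^ card (B \<inter> Z) * (b + 1) ^ card (B \<inter> - Z)"
      by (subst prod.If_cases[OF B]) simp
    also have "\<dots> \<le> (d + 1) ^ D * (b + 1) ^ card B"
    proof (intro mult_mono power_increasing)
      show "card (B \<inter> Z) \<le> D"
        using Z card_mono[of Z "B \<inter> Z"] finite_subset[OF _ B, of Z] by (auto simp: Zs_def)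
      show "card (B \<inter> - Z) \<le> card B" by (rule card_mono[OF B]) auto
    qed auto
    finally show ?thesis by (simp add: mult.commute)
  qed
  show "finite S" using finZ finM by (intro finite_subset[OF sub]) auto
  have "card S \<le> card (\<Union>Z\<in>Zs. M Z)" using finZ finM by (intro card_mono sub) auto
  also have "\<dots> \<le> (\<Sum>Z\<in>Zs. card (M Z))" by (rule card_UN_le[OF finZ])
  also have "\<dots> \<le> card Zs * ((b + 1) ^ card B * (d + 1) ^ D)"
    using sum_bounded_above[of Zs "\<lambda>Z. card (M Z)", OF cM] by simp
  also have "\<dots> \<le> 2 ^ card B * ((b + 1) ^ card B * (d + 1) ^ D)"
    by (rule mult_right_mono[OF cZ]) simp
  finally show "card S \<le> 2 ^ card B * (b + 1) ^ card B * (d + 1) ^ D"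
    by (simp add: mult.assoc)
qed

text \<open>One relation is taken for each set of \<open>D + 1\<close> variables in
  \<open>B\<close>. Division by these finitely many relations leaves only monomials divisible by
  none of their leading monomials. The constant \<open>C\<close> depends on \<open>B\<close>, the
  exponent \<open>D\<close> does not.\<close>

lemma standard_monomials:
  fixes K :: "'k::field witt_poly set"
  assumes I: "ideal K witt_sym" and D: "bounded_transcendence D K" and B: "finite B"
  obtains C where "\<And>d. \<exists>S. finite S \<and> card S \<le> C * (d + 1) ^ D \<and>
    (\<forall>f\<in>poly_space d B. \<exists>r. Poly_Mapping.keys r \<subseteq> S \<and> f - r \<in> K)"
proof -
  define Ys where "Ys = {Y. Y \<subseteq> B \<and> card Y = D + 1}"
  have finYs: "finite Ys" using B by (simp add: Ys_def)
  have "\<exists>h m. h \<in> K \<and> witt_vars h \<subseteq> Y \<and> leading_mon h m" if "Y \<in> Ys" for Y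
  proof -
    have "finite Y" "D < card Y" using that finite_subset[OF _ B] by (auto simp: Ys_def)
    then obtain h where "h \<in> K" "h \<noteq> 0" "witt_vars h \<subseteq> Y"
      using D by (auto simp: bounded_transcendence_def)
    then show ?thesis using leading_mon_exists by blast
  qed
  then obtain h lm where h: "\<And>Y. Y \<in> Ys \<Longrightarrow> h Y \<in> K" "\<And>Y. Y \<in> Ys \<Longrightarrow> witt_vars (h Y) \<subseteq> Y"
      "\<And>Y. Y \<in> Ys \<Longrightarrow> leading_mon (h Y) (lm Y)"
    by metis
  have lmY: "Poly_Mapping.keys (lm Y) \<subseteq> Y" if "Y \<in> Ys" for Y
    using h(2,3)[OF that] by (auto simp: leading_mon_def witt_vars_def)
  \<comment> \<open>A common bound for the exponents in all chosen leading monomials: a monomial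
    with \<open>D + 1\<close> exponents above \<open>b\<close> is divisible by one of them.\<close>
  define b where "b = (\<Sum>Y\<in>Ys. mon_deg (lm Y))"
  have lmb: "mon_deg (lm Y) \<le> b" if "Y \<in> Ys" for Y
    unfolding b_def using that finYs by (intro member_le_sum) auto
  define S where "S d = {m. Poly_Mapping.keys m \<subseteq> B \<and> mon_deg m \<le> d \<and>
      (\<forall>Y\<in>Ys. \<forall>l. m \<noteq> lm Y + l)}" for d
  have sparse: "card {p \<in> B. b < Poly_Mapping.lookup m p} \<le> D" if m: "m \<in> S d" for m d
  proof (rule ccontr)
    assume "\<not> ?thesis"
    then obtain Y where Y: "Y \<subseteq> {p \<in> B. b < Poly_Mapping.lookup m p}" "card Y = D + 1"
      using obtain_subset_with_card_n[of "D + 1" "{p \<in> B. b < Poly_Mapping.lookup m p}"] by force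
    then have YY: "Y \<in> Ys" by (auto simp: Ys_def)
    have "Poly_Mapping.lookup (lm Y) p \<le> Poly_Mapping.lookup m p" for p
    proof (cases "p \<in> Y")
      case True
      then show ?thesis
        using Y(1) lookup_le_mon_deg[of "lm Y" p] lmb[OF YY] by fastforce
    next
      case False
      then have "p \<notin> Poly_Mapping.keys (lm Y)" using lmY[OF YY] by blast
      then show ?thesis by (simp add: in_keys_iff)
    qed
    then have "m = lm Y + (m - lm Y)"
      by (intro poly_mapping_eqI) (simp add: lookup_add lookup_minus)
    then show False using m YY unfolding S_def by blast
  qed
  have card: "finite (S d)" "card (S d) \<le> 2 ^ card B * (b + 1) ^ card B * (d + 1) ^ D" for d
  proof -
    have "Poly_Mapping.keys m \<subseteq> B \<and> mon_deg m \<le> d \<and>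
        card {p \<in> B. b < Poly_Mapping.lookup m p} \<le> D" if m: "m \<in> S d" for m
      using sparse[OF m] m by (simp add: S_def)
    from card_sparse_monomials[OF B this]
    show "finite (S d)" "card (S d) \<le> 2 ^ card B * (b + 1) ^ card B * (d + 1) ^ D" by blast+
  qed
  \<comment> \<open>Division with remainder by induction on the rank. The order is graded, so the
    degree bound \<open>d\<close> is preserved.\<close>
  have mon: "\<exists>r. Poly_Mapping.keys r \<subseteq> S d \<and> Poly_Mapping.single m c - r \<in> K"
    if "Poly_Mapping.keys m \<subseteq> B" "mon_deg m \<le> d" for m c d
    using that
  proof (induction "mon_rank B m" arbitrary: m c rule: less_induct)
    case less
    show ?case
    proof (cases "m \<in> S d")
      case True
      then show ?thesis
        using ideal_witt_sym_0[OF I] by (intro exI[of _ "Poly_Mapping.single m c"]) auto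
    next
      case False
      then obtain Y l where Y: "Y \<in> Ys" "m = lm Y + l" using less.prems by (auto simp: S_def)
      define a where "a = Poly_Mapping.lookup (h Y) (lm Y)"
      have a0: "a \<noteq> 0" using h(3)[OF Y(1)] by (simp add: a_def leading_mon_def in_keys_iff)
      \<comment> \<open>The multiple of the relation \<open>h Y\<close> whose leading term is the
        given one.\<close>
      define s where "s = Poly_Mapping.single l (c / a) * h Y"
      have s: "s \<in> K" unfolding s_def by (rule ideal_witt_sym_mult[OF I h(1)[OF Y(1)]])
      define e where "e = Poly_Mapping.single m c - s"
      have em: "Poly_Mapping.lookup e m = 0"
        using a0 by (simp add: e_def s_def lookup_minus Y(2) lookup_single_mult a_def)
      have low: "mon_less k m \<and> Poly_Mapping.keys k \<subseteq> B" if k: "k \<in> Poly_Mapping.keys e" for k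
      proof -
        have km: "k \<noteq> m" using em k by (auto simp: in_keys_iff)
        then have "k \<in> Poly_Mapping.keys s"
          using k by (simp add: e_def in_keys_iff lookup_minus lookup_single when_def)
        then obtain k' where k': "k' \<in> Poly_Mapping.keys (h Y)" "k = k' + l"
          using keys_single_mult unfolding s_def by blast
        then have "mon_less k' (lm Y)"
          using h(3)[OF Y(1)] km Y(2) by (auto simp: leading_mon_def)
        then have "mon_less k m" using mon_less_add k'(2) Y(2) by simp
        moreover have "Poly_Mapping.keys k' \<subseteq> Y"
          using h(2)[OF Y(1)] k'(1) by (auto simp: witt_vars_def)
        then have "Poly_Mapping.keys k \<subseteq> B"
          using less.prems(1) Y k'(2) by (auto simp: Ys_def keys_add_nat)
        ultimately show ?thesis by simp
      qed
      have "\<exists>r. Poly_Mapping.keys r \<subseteq> S d \<and>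
          Poly_Mapping.single k (Poly_Mapping.lookup e k) - r \<in> K"
        if "k \<in> Poly_Mapping.keys e" for k
        using low[OF that] mon_rank_less[OF B, of k m] mon_less_deg[of k m] less.prems(2)
        by (intro less.hyps) auto
      then obtain r where r: "\<And>k. k \<in> Poly_Mapping.keys e \<Longrightarrow> Poly_Mapping.keys (r k) \<subseteq> S d"
          "\<And>k. k \<in> Poly_Mapping.keys e \<Longrightarrow>
            Poly_Mapping.single k (Poly_Mapping.lookup e k) - r k \<in> K"
        by metis
      define R where "R = (\<Sum>k\<in>Poly_Mapping.keys e. r k)"
      have "Poly_Mapping.keys R \<subseteq> S d"
        unfolding R_def using r(1) keys_sum[of r "Poly_Mapping.keys e"] by blast
      moreover have "e - R \<in> K"
      proof -
        have "e - R = (\<Sum>k\<in>Poly_Mapping.keys e.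
            Poly_Mapping.single k (Poly_Mapping.lookup e k) - r k)"
          unfolding R_def sum_subtractf by (simp flip: witt_poly_sum_monomials)
        then show ?thesis using ideal_witt_sym_sum[OF I r(2)] by simp
      qed
      then have "Poly_Mapping.single m c - R \<in> K"
        using ideal_witt_sym_add[OF I _ s, of "e - R"] by (simp add: e_def)
      ultimately show ?thesis by blast
    qed
  qed
  have red: "\<exists>r. Poly_Mapping.keys r \<subseteq> S d \<and> f - r \<in> K" if f: "f \<in> poly_space d B" for f d
  proof -
    have "\<exists>r. Poly_Mapping.keys r \<subseteq> S d \<and>
        Poly_Mapping.single k (Poly_Mapping.lookup f k) - r \<in> K"
      if "k \<in> Poly_Mapping.keys f" for k
      using f that by (intro mon) (auto simp: poly_space_def)
    then obtain r where r: "\<And>k. k \<in> Poly_Mapping.keys f \<Longrightarrow> Poly_Mapping.keys (r k) \<subseteq> S d"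
        "\<And>k. k \<in> Poly_Mapping.keys f \<Longrightarrow>
          Poly_Mapping.single k (Poly_Mapping.lookup f k) - r k \<in> K"
      by metis
    have "f - (\<Sum>k\<in>Poly_Mapping.keys f. r k) = (\<Sum>k\<in>Poly_Mapping.keys f.
        Poly_Mapping.single k (Poly_Mapping.lookup f k) - r k)"
      unfolding sum_subtractf by (simp flip: witt_poly_sum_monomials)
    then have "f - (\<Sum>k\<in>Poly_Mapping.keys f. r k) \<in> K" using ideal_witt_sym_sum[OF I r(2)] by simp
    moreover have "Poly_Mapping.keys (\<Sum>k\<in>Poly_Mapping.keys f. r k) \<subseteq> S d"
      using r(1) keys_sum[of r "Poly_Mapping.keys f"] by blast
    ultimately show ?thesis by blast
  qed
  show ?thesis
    by (rule that[of "2 ^ card B * (b + 1) ^ card B"]) (use card red in blast)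
qed

section \<open>Dimensions of subspaces of the quotient\<close>

text \<open>By the exchange property \<open>replacement\<close>, linearly independent subsets of
  \<open>W\<close> have at most \<open>card G\<close> elements. Hence a maximal one exists, and it
  is a finite basis of \<open>W\<close>.\<close>

lemma (in vectorspace) dim_subspace_le:
  assumes W: "submodule K W V" and G: "finite G" "G \<subseteq> carrier V" and sub: "W \<subseteq> span G"
  shows "vectorspace.dim K (vs W) \<le> card G"
proof -
  have "subspace K W V" using W vectorspace_axioms by (simp add: subspace_def)
  then interpret W: vectorspace K "vs W" by (rule subspace_is_vs)
  have fin_le: "card A \<le> card G" if A: "A \<subseteq> W" "\<not> W.lin_dep A" "finite A" for A
  proof -
    have "lin_indpt A" using A(2) span_li_not_depend(2)[OF A(1) W] by simp
    from replacement[OF A(3) G this] A(1) sub show ?thesis by force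
  qed
  have bound: "finite A \<and> card A \<le> card G" if A: "A \<subseteq> carrier (vs W) \<and> \<not> W.lin_dep A" for A
  proof -
    have AW: "A \<subseteq> W" using A by simp
    have "finite A"
    proof (rule ccontr)
      assume "infinite A"
      then obtain A' where A': "A' \<subseteq> A" "finite A'" "card A' = Suc (card G)"
        using infinite_arbitrarily_large by blast
      have "card A' \<le> card G"
        by (rule fin_le) (use A' AW W.subset_li_is_li[OF conjunct2[OF A] A'(1)] in auto)
      then show False using A'(3) by simp
    qed
    then show ?thesis using fin_le AW A by blast
  qed
  have "\<exists>A. finite A \<and> maximal A (\<lambda>A. A \<subseteq> carrier (vs W) \<and> \<not> W.lin_dep A)"
    by (rule maximal_exists[where B = "{}", OF bound]) (auto simp: W.lin_dep_def)
  then obtain A where A: "finite A" "maximal A (\<lambda>A. A \<subseteq> carrier (vs W) \<and> \<not> W.lin_dep A)"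
    by blast
  have "W.dim = card A" by (rule W.dim_basis[OF A(1) W.max_li_is_basis[OF A(2)]])
  also have "\<dots> \<le> card G" using bound A(2) by (simp add: maximal_def)
  finally show ?thesis .
qed

section \<open>Computing in the quotient algebra with representatives\<close>

abbreviation witt_class :: "'k::field witt_poly set \<Rightarrow> 'k witt_poly \<Rightarrow> 'k witt_poly set" where
  "witt_class K f \<equiv> K +>\<^bsub>witt_sym\<^esub> f"

context
  fixes K :: "'k::field witt_poly set"
  assumes I: "ideal K witt_sym"
begin

abbreviation (input) "Q \<equiv> quot_algebra (witt_sym :: ('k, 'k witt_poly) module) K"

lemma mem_witt_class_iff: "x \<in> witt_class K f \<longleftrightarrow> x - f \<in> K"
proof -
  have "x \<in> witt_class K f \<longleftrightarrow> (\<exists>h\<in>K. x = h + f)"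
    by (auto simp: a_r_coset_def' witt_sym_def)
  also have "\<dots> \<longleftrightarrow> x - f \<in> K" by (auto intro: bexI[of _ "x - f"])
  finally show ?thesis .
qed

lemma witt_class_eq_iff: "witt_class K f = witt_class K g \<longleftrightarrow> f - g \<in> K"
proof
  assume "witt_class K f = witt_class K g"
  moreover have "f \<in> witt_class K f" by (simp add: mem_witt_class_iff ideal_witt_sym_0[OF I])
  ultimately show "f - g \<in> K" by (simp add: mem_witt_class_iff)
next
  assume d: "f - g \<in> K"
  have "x \<in> witt_class K f \<longleftrightarrow> x \<in> witt_class K g" for x
    unfolding mem_witt_class_iff
    using ideal_witt_sym_add[OF I _ d, of "x - f"] ideal_witt_sym_diff[OF I _ d, of "x - g"]
    by auto
  then show "witt_class K f = witt_class K g" by blast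
qed

lemma quot_carrier: "carrier Q = range (witt_class K)"
  by (auto simp: quot_algebra_def FactRing_def A_RCOSETS_def' witt_sym_def)

lemma quot_zero: "\<zero>\<^bsub>Q\<^esub> = witt_class K 0"
  and quot_one: "\<one>\<^bsub>Q\<^esub> = witt_class K 1"
  by (auto simp: quot_algebra_def FactRing_def a_r_coset_def' witt_sym_def)

lemma quot_add: "witt_class K f \<oplus>\<^bsub>Q\<^esub> witt_class K g = witt_class K (f + g)"
  and quot_mult: "witt_class K f \<otimes>\<^bsub>Q\<^esub> witt_class K g = witt_class K (f * g)"
proof -
  have "f \<in> carrier witt_sym" "g \<in> carrier witt_sym" by (simp_all add: witt_sym_def)
  from ideal.a_rcos_sum[OF I this] ideal.rcoset_mult_add[OF I this]
  show "witt_class K f \<oplus>\<^bsub>Q\<^esub> witt_class K g = witt_class K (f + g)"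
    "witt_class K f \<otimes>\<^bsub>Q\<^esub> witt_class K g = witt_class K (f * g)"
    by (simp_all add: quot_algebra_def FactRing_def) (simp_all add: witt_sym_def)
qed

text \<open>All representatives of a class yield the same class after scaling, so the union in the
  definition of \<open>quot_algebra\<close> collapses to a single class.\<close>

lemma quot_smult: "c \<odot>\<^bsub>Q\<^esub> witt_class K f = witt_class K (witt_const c * f)"
proof -
  have "witt_class K (witt_const c * x) = witt_class K (witt_const c * f)"
    if "x \<in> witt_class K f" for x
  proof -
    have "witt_const c * (x - f) \<in> K"
      using that by (intro ideal_witt_sym_mult[OF I]) (simp add: mem_witt_class_iff)
    then show ?thesis by (simp add: witt_class_eq_iff right_diff_distrib)
  qed
  moreover have "f \<in> witt_class K f" by (simp add: mem_witt_class_iff ideal_witt_sym_0[OF I])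
  ultimately have "(\<Union>x\<in>witt_class K f. witt_class K (witt_const c * x)) =
      witt_class K (witt_const c * f)"
    by blast
  then show ?thesis by (simp add: quot_algebra_def) (simp add: witt_sym_def)
qed

lemma quot_vectorspace: "vectorspace (class_ring :: 'k ring) Q"
proof -
  interpret algebra "class_ring :: 'k ring" Q
    by (rule algebra_quot_algebra[OF algebra_witt_sym I])
  show ?thesis unfolding vectorspace_def by (intro conjI module_axioms class_field)
qed

interpretation QV: vectorspace "class_ring :: 'k ring" Q
  by (rule quot_vectorspace)

section \<open>The degree filtration of the quotient and the growth of subspace powers\<close>

definition class_space :: "nat \<Rightarrow> nat set \<Rightarrow> 'k witt_poly set set" where
  "class_space d B = witt_class K ` poly_space d B"

lemma submodule_class_space: "submodule (class_ring :: 'k ring) (class_space d B) Q"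
proof (rule submodule.intro)
  show "module (class_ring :: 'k ring) Q" by (rule QV.module_axioms)
  show "class_space d B \<subseteq> carrier Q" by (auto simp: class_space_def quot_carrier)
  show "\<zero>\<^bsub>Q\<^esub> \<in> class_space d B" by (auto simp: class_space_def quot_zero)
  show "v \<oplus>\<^bsub>Q\<^esub> w \<in> class_space d B" if "v \<in> class_space d B" "w \<in> class_space d B" for v w
    using that by (auto simp: class_space_def quot_add intro: poly_space_add)
  show "c \<odot>\<^bsub>Q\<^esub> v \<in> class_space d B"
    if "c \<in> carrier (class_ring :: 'k ring)" "v \<in> class_space d B" for c v
    using that by (auto simp: class_space_def quot_smult intro: poly_space_smult)
qed

lemma class_space_mono: "d \<le> e \<Longrightarrow> B \<subseteq> C \<Longrightarrow> class_space d B \<subseteq> class_space e C"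
  unfolding class_space_def by (intro image_mono poly_space_mono)

lemma span_subset_class_space:
  "S \<subseteq> class_space d B \<Longrightarrow> QV.span S \<subseteq> class_space d B"
  by (rule QV.span_is_subset[OF _ submodule_class_space])

text \<open>A finite spanning set has representatives that involve finitely many variables and have
  bounded degree.\<close>

lemma fin_dim_subset_class_space:
  assumes V: "VectorSpace.subspace (class_ring :: 'k ring) V Q"
    and fd: "vectorspace.fin_dim (class_ring :: 'k ring) (Q\<lparr>carrier := V\<rparr>)"
  obtains d B where "finite B" "V \<subseteq> class_space d B"
proof -
  interpret V: vectorspace "class_ring :: 'k ring" "Q\<lparr>carrier := V\<rparr>"
    by (rule QV.subspace_is_vs[OF V])
  have sub: "submodule (class_ring :: 'k ring) V Q" by (rule QV.is_module[OF V])
  obtain A where A: "finite A" "A \<subseteq> V" "V.span A = V"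
    using fd unfolding V.fin_dim_def by auto
  have "V = QV.span A" using QV.span_li_not_depend(1)[OF A(2) sub] A(3) by simp
  moreover have "\<exists>d B. finite B \<and> A \<subseteq> class_space d B"
    using A(1) subset_trans[OF A(2) submodule.subset[OF sub]]
  proof (induction A)
    case (insert x A)
    then obtain d B where dB: "finite B" "A \<subseteq> class_space d B" by (elim meta_impE exE conjE) simp_all
    from insert.prems obtain f where f: "x = witt_class K f" by (auto simp: quot_carrier)
    obtain e where e: "f \<in> poly_space e (witt_vars f)" by (rule poly_space_exists)
    have "x \<in> class_space e (witt_vars f)" unfolding class_space_def f by (rule imageI[OF e])
    moreover have "class_space e (witt_vars f) \<subseteq> class_space (max d e) (B \<union> witt_vars f)"
      "class_space d B \<subseteq> class_space (max d e) (B \<union> witt_vars f)"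
      by (intro class_space_mono; simp)+
    ultimately have "insert x A \<subseteq> class_space (max d e) (B \<union> witt_vars f)"
      using dB(2) by (intro insert_subsetI) (rule subsetD, assumption+, rule order.trans)
    moreover have "finite (B \<union> witt_vars f)" using dB(1) finite_witt_vars by simp
    ultimately show ?case by (intro exI conjI)
  qed (intro exI[of _ 0] exI[of _ "{}"], simp)
  then obtain d B where dB: "finite B" "A \<subseteq> class_space d B" by (elim exE conjE)
  ultimately have "V \<subseteq> class_space d B" using span_subset_class_space[OF dB(2)] by simp
  then show ?thesis by (rule that[OF dB(1)])
qed

lemma subspace_power_subset:
  assumes "V \<subseteq> class_space d B"
  shows "subspace_power (class_ring :: 'k ring) Q V k \<subseteq> class_space (k * d) B"
proof (induction k)
  case 0
  have "{\<one>\<^bsub>Q\<^esub>} \<subseteq> class_space 0 B" by (auto simp: class_space_def quot_one poly_space_1)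
  then show ?case using span_subset_class_space by simp
next
  case (Suc k)
  have "v \<otimes>\<^bsub>Q\<^esub> w \<in> class_space (Suc k * d) B"
    if vw: "v \<in> subspace_power (class_ring :: 'k ring) Q V k" "w \<in> V" for v w
  proof -
    from subsetD[OF Suc vw(1)] obtain f where f: "v = witt_class K f" "f \<in> poly_space (k * d) B"
      unfolding class_space_def by (rule imageE)
    from subsetD[OF assms vw(2)] obtain g where g: "w = witt_class K g" "g \<in> poly_space d B"
      unfolding class_space_def by (rule imageE)
    have "f * g \<in> poly_space (Suc k * d) B"
      using poly_space_mult[OF f(2) g(2)] by (simp add: add.commute)
    then show ?thesis unfolding class_space_def f g quot_mult by (rule imageI)
  qed
  then show ?case
    unfolding subspace_power.simps
    by (intro span_subset_class_space subsetI) (elim CollectE exE conjE, simp only:)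
qed

lemma subspace_power_sum_subset:
  assumes "V \<subseteq> class_space d B"
  shows "subspace_power_sum (class_ring :: 'k ring) Q V n \<subseteq> class_space (n * d) B"
  unfolding subspace_power_sum_def
proof (rule span_subset_class_space, rule UN_least)
  fix k assume "k \<in> {..n}"
  then show "subspace_power (class_ring :: 'k ring) Q V k \<subseteq> class_space (n * d) B"
    using subspace_power_subset[OF assms, of k] class_space_mono[of "k * d" "n * d" B B] by auto
qed

lemma class_in_span:
  assumes "finite S" "Poly_Mapping.keys r \<subseteq> S"
  shows "witt_class K r \<in> QV.span ((\<lambda>m. witt_class K (Poly_Mapping.single m 1)) ` S)"
    (is "_ \<in> QV.span ?G")
proof -
  have G: "?G \<subseteq> carrier Q" by (auto simp: quot_carrier)
  interpret G: submodule "class_ring :: 'k ring" "QV.span ?G" Q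
    by (rule QV.span_is_submodule[OF G])
  have "witt_class K (\<Sum>m\<in>A. Poly_Mapping.single m (Poly_Mapping.lookup r m)) \<in> QV.span ?G"
    if "finite A" "A \<subseteq> S" for A
    using that
  proof (induction A)
    case empty
    then show ?case using G.zero_closed by (simp add: quot_zero)
  next
    case (insert m A)
    have "witt_class K (Poly_Mapping.single m 1) \<in> QV.span ?G"
      using QV.in_own_span[OF G] insert.prems by blast
    then have "Poly_Mapping.lookup r m \<odot>\<^bsub>Q\<^esub> witt_class K (Poly_Mapping.single m 1) \<in> QV.span ?G"
      by (intro G.smult_closed) auto
    then have "witt_class K (Poly_Mapping.single m (Poly_Mapping.lookup r m)) \<in> QV.span ?G"
      by (simp add: quot_smult witt_const_def mult_single)
    then have "witt_class K (Poly_Mapping.single m (Poly_Mapping.lookup r m)) \<oplus>\<^bsub>Q\<^esub>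
        witt_class K (\<Sum>m\<in>A. Poly_Mapping.single m (Poly_Mapping.lookup r m)) \<in> QV.span ?G"
      using insert by (intro G.m_closed) auto
    then show ?case using insert.hyps by (simp add: quot_add)
  qed
  from this[OF finite_keys[of r] assms(2)] show ?thesis
    by (simp flip: witt_poly_sum_monomials)
qed

text \<open>The sum up to the \<open>n\<close>-th power consists of classes of polynomials of degree
  at most \<open>n * c\<close>, and these are spanned by the classes of standard monomials. The
  constant \<open>C\<close> is the same for all \<open>n\<close>.\<close>

lemma dim_subspace_power_sum_le:
  assumes D: "bounded_transcendence D K" and B: "finite B" and V: "V \<subseteq> class_space c B"
  obtains C where "\<And>n. vectorspace.dim (class_ring :: 'k ring)
      (Q\<lparr>carrier := subspace_power_sum (class_ring :: 'k ring) Q V n\<rparr>) \<le> C * (n * c + 1) ^ D"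
proof -
  obtain C where C: "\<And>d. \<exists>S. finite S \<and> card S \<le> C * (d + 1) ^ D \<and>
      (\<forall>f\<in>poly_space d B. \<exists>r. Poly_Mapping.keys r \<subseteq> S \<and> f - r \<in> K)"
    using standard_monomials[OF I D B] by blast
  show ?thesis
  proof (rule that[of C])
    fix n
    let ?W = "subspace_power_sum (class_ring :: 'k ring) Q V n"
    obtain S where S: "finite S" "card S \<le> C * (n * c + 1) ^ D"
      "\<And>f. f \<in> poly_space (n * c) B \<Longrightarrow> \<exists>r. Poly_Mapping.keys r \<subseteq> S \<and> f - r \<in> K"
      using C[of "n * c"] by blast
    let ?G = "(\<lambda>m. witt_class K (Poly_Mapping.single m 1)) ` S"
    have G: "finite ?G" "?G \<subseteq> carrier Q" using S(1) by (auto simp: quot_carrier)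
    have "class_space (n * c) B \<subseteq> QV.span ?G"
    proof
      fix x assume "x \<in> class_space (n * c) B"
      then obtain f where f: "x = witt_class K f" "f \<in> poly_space (n * c) B"
        by (auto simp: class_space_def)
      obtain r where r: "Poly_Mapping.keys r \<subseteq> S" "f - r \<in> K" using S(3)[OF f(2)] by blast
      then have "x = witt_class K r" using f(1) witt_class_eq_iff by simp
      then show "x \<in> QV.span ?G" using class_in_span[OF S(1) r(1)] by simp
    qed
    then have sub: "?W \<subseteq> QV.span ?G" using subspace_power_sum_subset[OF V, of n] by blast
    have "subspace_power (class_ring :: 'k ring) Q V k \<subseteq> carrier Q" for k
      using subspace_power_subset[OF V, of k] submodule.subset[OF submodule_class_space] by blast
    then have "submodule (class_ring :: 'k ring) ?W Q"
      unfolding subspace_power_sum_def by (intro QV.span_is_submodule UN_least)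
    from QV.dim_subspace_le[OF this G sub]
    have "vectorspace.dim (class_ring :: 'k ring) (Q\<lparr>carrier := ?W\<rparr>) \<le> card ?G" .
    also have "\<dots> \<le> card S" by (rule card_image_le[OF S(1)])
    finally show "vectorspace.dim (class_ring :: 'k ring) (Q\<lparr>carrier := ?W\<rparr>) \<le> C * (n * c + 1) ^ D"
      using S(2) by linarith
  qed
qed

end

section \<open>From polynomial growth to the Gelfand-Kirillov dimension\<close>

text \<open>The constant \<open>C * (c + 1) ^ D\<close> is absorbed into one additional factor
  \<open>n\<close>, which costs one in the exponent; the cruder bound \<open>D + 1\<close> is enough
  for finiteness.\<close>

lemma limsup_log_dim_le:
  fixes d :: "nat \<Rightarrow> nat"
  assumes "\<And>n. d n \<le> C * (n * c + 1) ^ D"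
  shows "limsup (\<lambda>n. log_dim n (d n)) \<le> ereal (real (D + 1))"
proof (rule Limsup_bounded)
  \<comment> \<open>The threshold \<open>2\<close> makes the base of the logarithm exceed 1, the
    other one lets \<open>n\<close> dominate the constant.\<close>
  have "log_dim n (d n) \<le> ereal (real (D + 1))" if n: "n \<ge> max 2 (C * (c + 1) ^ D)" for n
  proof (cases "d n = 0")
    case False
    have "d n \<le> C * (n * c + 1) ^ D" by (rule assms)
    also have "\<dots> \<le> C * (n * (c + 1)) ^ D" using n by (intro mult_left_mono power_mono) auto
    also have "\<dots> = (C * (c + 1) ^ D) * n ^ D" by (simp only: power_mult_distrib mult_ac)
    also have "\<dots> \<le> n * n ^ D" using n by (intro mult_right_mono) auto
    finally have "real (d n) \<le> real n ^ (D + 1)" by (metis of_nat_le_iff of_nat_power power_Suc Suc_eq_plus1)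
    then have "log (real n) (real (d n)) \<le> log (real n) (real n ^ (D + 1))"
      using n False by (subst log_le_cancel_iff) auto
    also have "\<dots> = real (D + 1)" using n by (subst log_nat_power) auto
    finally show ?thesis using False by (simp add: log_dim_def)
  qed (simp add: log_dim_def)
  then show "\<forall>\<^sub>F n in sequentially. log_dim n (d n) \<le> ereal (real (D + 1))"
    by (rule eventually_sequentiallyI)
qed

text \<open>The subspace \<open>V\<close> influences only the constants \<open>c\<close> and
  \<open>C\<close>, not the exponent \<open>D\<close>, so the bound survives the supremum over all
  \<open>V\<close>.\<close>

lemma gk_dim_quot_le:
  fixes K :: "'k::field witt_poly set"
  assumes I: "ideal K witt_sym" and D: "bounded_transcendence D K"
  shows "gk_dim (class_ring :: 'k ring) (quot_algebra witt_sym K) \<le> ereal (real (D + 1))"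
  unfolding gk_dim_def
proof (rule SUP_least, elim CollectE conjE)
  fix V assume V: "VectorSpace.subspace (class_ring :: 'k ring) V (quot_algebra witt_sym K)"
    "vectorspace.fin_dim (class_ring :: 'k ring) (quot_algebra witt_sym K\<lparr>carrier := V\<rparr>)"
  obtain c B where "finite B" "V \<subseteq> class_space K c B"
    by (rule fin_dim_subset_class_space[OF I V])
  then obtain C where "\<And>n. vectorspace.dim (class_ring :: 'k ring) (quot_algebra witt_sym K\<lparr>carrier :=
      subspace_power_sum (class_ring :: 'k ring) (quot_algebra witt_sym K) V n\<rparr>) \<le> C * (n * c + 1) ^ D"
    using dim_subspace_power_sum_le[OF I D] by blast
  then show "limsup (\<lambda>n. log_dim n (vectorspace.dim (class_ring :: 'k ring)
      (quot_algebra witt_sym K\<lparr>carrier :=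
        subspace_power_sum (class_ring :: 'k ring) (quot_algebra witt_sym K) V n\<rparr>))) \<le> ereal (real (D + 1))"
    by (rule limsup_log_dim_le)
qed

theorem theorem1p4:
  fixes K :: "'k::field_char_0 witt_poly set"
  assumes "witt_poisson_ideal K"
    and "K \<noteq> {0}"
  shows "finite {P. minimal_prime_over witt_sym K P}
    \<and> gk_dim (class_ring :: 'k ring) (quot_algebra witt_sym K) < \<infinity>"
proof -
  have I: "ideal K witt_sym" using assms(1) by (simp add: witt_poisson_ideal_def)
  obtain f where f: "f \<in> K" "f \<noteq> 0" using assms(2) ideal_witt_sym_0[OF I] by blast
  obtain d where "f \<in> poly_space d UNIV" using poly_space_witt_vars[of f UNIV] by blast
  from poisson_ideal_finiteness[OF assms(1) f this]
  obtain D where fin: "finite {P. minimal_prime_over witt_sym K P}" and D: "bounded_transcendence D K"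
    by blast
  have "gk_dim (class_ring :: 'k ring) (quot_algebra witt_sym K) \<le> ereal (real (D + 1))"
    by (rule gk_dim_quot_le[OF I D])
  also have "\<dots> < \<infinity>" by simp
  finally show ?thesis using fin by simp
qed

end
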